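(* Let $\mathcal E$ and $\overline{\mathcal E}$ be two regular Abel equations (of the form $y'=a(x)y^3+b(x)y^2+c(x)y+d(x)$, $a\ne0$). Then $\mathcal E$ and $\overline{\mathcal E}$ are locally $G$-equivalent if and only if $\Sigma_{\mathcal E}=\Sigma_{\overline{\mathcal E}}$.
   Context: Abel equations are ODEs $y'=a(x)y^3+b(x)y^2+c(x)y+d(x)$ with $a,b,c,d$ of class $C^\infty$ and $a\neq 0$; they are identified with sections of the bundle $\pi:\mathbb{R}^5\to\mathbb{R}$, $(x,a,b,c,d)\mapsto x$. $G$ is the pseudogroup of local (invertible) point transformations $x\mapsto f(x)$, $y\mapsto g(x)\cdot y+h(x)$, with $f,g,h$ smooth ($f'\neq0$, $g\neq 0$). Two equations are locally $G$-equivalent if some (locally defined) transformation in $G$ transforms one into the other. Put $$s_1=a,\qquad s_3=a'b-b'a+abc-\tfrac29b^3-3a^2d,\qquad s_5=a\frac{ds_3}{dx}-3s_3\left(a'+ac-\tfrac13b^2\right),$$ $$J_1=\frac{s_5^3}{s_3^5},\qquad \nabla=\frac{s_1}{s_3^{2/3}}\frac{D}{Dx},$$ where $\frac{D}{Dx}$ is the total derivative with respect to $x$. For an equation $\mathcal E$, a superscript $\mathcal E$ means evaluation at the coefficients of $\mathcal E$, giving functions of $x$. For an open interval $\Delta\subset\mathbb R$ define $\sigma_{\mathcal E}:\Delta\to\mathbb{R}^2$, with coordinates $(j_1,j_{11})$ on $\mathbb R^2$, by $j_1=J_1^{\mathcal E}$, $j_{11}=(\nabla J_1)^{\mathcal E}$,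 and set $\Sigma_{\mathcal E}=\operatorname{im}(\sigma_{\mathcal E})\subset\mathbb R^2$. A point of a jet space $J^k(\pi)$ is regular if $s_1s_3\neq0$ at it, and a regular orbit is the $G$-orbit of a regular point. The equation $\mathcal E$ is regular at a point $x\in\mathbb R$ if: (i) the 2-jets of the coefficients of $\mathcal E$ belong to regular orbits; (ii) $\sigma_{\mathcal E}(\Delta)$ is a smooth curve in $\mathbb R^2$ for some open interval $\Delta$ containing $x$; (iii) one of the functions $j_1,j_{11}$ can be chosen as a local coordinate on $\Sigma_{\mathcal E}$. The curves $\Sigma_{\mathcal E}$, $\Sigma_{\overline{\mathcal E}}$ in the claim are those of the definition of regularity. *)

theory Defs
  imports "HOL-Analysis.Analysis"
begin

definition open_interval :: "real set \<Rightarrow> bool" where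
  "open_interval U \<longleftrightarrow> open U \<and> is_interval U \<and> U \<noteq> {}"

text \<open>Class \<open>C\<^sup>\<infinity>\<close>; only used for open \<open>U\<close>, where \<^const>\<open>deriv\<close> depends on the values in \<open>U\<close> alone.\<close>

definition smooth_on :: "real set \<Rightarrow> (real \<Rightarrow> real) \<Rightarrow> bool" where
  "smooth_on U f \<longleftrightarrow> (\<forall>n. \<forall>x\<in>U. (deriv ^^ n) f field_differentiable (at x))"


section \<open>Abel equations\<close>

text \<open>
  The equation \<open>y' = a(x) y\<^sup>3 + b(x) y\<^sup>2 + c(x) y + d(x)\<close> over the base interval \<open>base\<close>,
  which may be \<^const>\<open>UNIV\<close>. Coefficient values outside of \<open>base\<close> are irrelevant.
\<close>

record abel =
  base :: "real set"
  ca :: "real \<Rightarrow> real"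
  cb :: "real \<Rightarrow> real"
  cc :: "real \<Rightarrow> real"
  cd :: "real \<Rightarrow> real"

definition abel_equation :: "abel \<Rightarrow> bool" where
  "abel_equation E \<longleftrightarrow>
     open_interval (base E) \<and>
     smooth_on (base E) (ca E) \<and> smooth_on (base E) (cb E) \<and>
     smooth_on (base E) (cc E) \<and> smooth_on (base E) (cd E) \<and>
     (\<forall>x\<in>base E. ca E x \<noteq> 0)"

definition rhs :: "abel \<Rightarrow> real \<Rightarrow> real \<Rightarrow> real" where
  "rhs E x y = ca E x * y ^ 3 + cb E x * y ^ 2 + cc E x * y + cd E x"


section \<open>The pseudogroup\<close>

text \<open>
  The local point transformation \<open>x \<mapsto> f(x)\<close>, \<open>y \<mapsto> g(x) y + h(x)\<close> over the open interval \<open>U\<close>.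
  As \<open>f'\<close> has no zero on the interval \<open>U\<close>, \<open>f\<close> is strictly monotone there, so the
  transformation is invertible.
\<close>

definition point_transformation ::
    "real set \<Rightarrow> (real \<Rightarrow> real) \<Rightarrow> (real \<Rightarrow> real) \<Rightarrow> (real \<Rightarrow> real) \<Rightarrow> bool" where
  "point_transformation U f g h \<longleftrightarrow>
     open_interval U \<and> smooth_on U f \<and> smooth_on U g \<and> smooth_on U h \<and>
     (\<forall>x\<in>U. deriv f x \<noteq> 0 \<and> g x \<noteq> 0)"

text \<open>
  An equation is the surface \<open>p = rhs E x y\<close> in the space of 1-jets \<open>(x, y, p)\<close>, \<open>p = y'\<close>. The
  transformation acts on this space by its first prolongation
  \<open>(x, y, p) \<mapsto> (f, g y + h, (g' y + g p + h') / f')\<close>, and takes \<open>E\<close> over \<open>U\<close> into \<open>F\<close>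
  over \<open>f ` U\<close> if the prolongation takes the first surface into the second.
\<close>

definition transforms ::
    "real set \<Rightarrow> (real \<Rightarrow> real) \<Rightarrow> (real \<Rightarrow> real) \<Rightarrow> (real \<Rightarrow> real) \<Rightarrow> abel \<Rightarrow> abel \<Rightarrow> bool" where
  "transforms U f g h E F \<longleftrightarrow>
     point_transformation U f g h \<and> U \<subseteq> base E \<and> f ` U \<subseteq> base F \<and>
     (\<forall>x\<in>U. \<forall>y p. p = rhs E x y \<longleftrightarrow>
        (deriv g x * y + g x * p + deriv h x) / deriv f x = rhs F (f x) (g x * y + h x))"

definition locally_equivalent :: "abel \<Rightarrow> abel \<Rightarrow> bool" where
  "locally_equivalent E F \<longleftrightarrow> (\<exists>U f g h. transforms U f g h E F)"


section \<open>Relative and absolute invariants, evaluated on an equation\<close>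

definition s1 :: "abel \<Rightarrow> real \<Rightarrow> real" where
  "s1 E x = ca E x"

definition s3 :: "abel \<Rightarrow> real \<Rightarrow> real" where
  "s3 E x = deriv (ca E) x * cb E x - deriv (cb E) x * ca E x + ca E x * cb E x * cc E x
     - 2 / 9 * cb E x ^ 3 - 3 * ca E x ^ 2 * cd E x"

definition s5 :: "abel \<Rightarrow> real \<Rightarrow> real" where
  "s5 E x = ca E x * deriv (s3 E) x
     - 3 * s3 E x * (deriv (ca E) x + ca E x * cc E x - 1 / 3 * cb E x ^ 2)"

definition J1 :: "abel \<Rightarrow> real \<Rightarrow> real" where
  "J1 E x = s5 E x ^ 3 / s3 E x ^ 5"

text \<open>
  The power \<open>s\<^sub>3\<^bsup>2/3\<^esup>\<close> is the square of the real cube root, also for negative \<open>s\<^sub>3\<close>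
  (\<^term>\<open>root 3\<close> is odd). On an equation the total derivative becomes the derivative.
\<close>

definition J11 :: "abel \<Rightarrow> real \<Rightarrow> real" where
  "J11 E x = s1 E x / (root 3 (s3 E x)) ^ 2 * deriv (J1 E) x"

definition sigma_map :: "abel \<Rightarrow> real \<Rightarrow> real \<times> real" where
  "sigma_map E x = (J1 E x, J11 E x)"


section \<open>Jets and regular orbits\<close>

text \<open>A \<open>k\<close>-jet: the base point and the values of the derivatives of order \<open>0, \<dots>, k\<close> of the
  four coefficients.\<close>

type_synonym jet = "real \<times> (real \<times> real \<times> real \<times> real) list"

definition jet_of :: "nat \<Rightarrow> abel \<Rightarrow> real \<Rightarrow> jet" where
  "jet_of k E x =
     (x, map (\<lambda>i. ((deriv ^^ i) (ca E) x, (deriv ^^ i) (cb E) x,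
                   (deriv ^^ i) (cc E) x, (deriv ^^ i) (cd E) x)) [0..<Suc k])"

text \<open>For \<open>k \<ge> 1\<close> the condition depends on the jet \<open>\<theta>\<close> only, not on the representative \<open>E\<close>.\<close>

definition regular_jet :: "nat \<Rightarrow> jet \<Rightarrow> bool" where
  "regular_jet k \<theta> \<longleftrightarrow>
     (\<exists>E x. abel_equation E \<and> x \<in> base E \<and> \<theta> = jet_of k E x \<and> s1 E x * s3 E x \<noteq> 0)"

definition jet_orbit :: "nat \<Rightarrow> jet \<Rightarrow> jet set" where
  "jet_orbit k \<theta> =
     {jet_of k F (f x) | E F U f g h x.
        abel_equation E \<and> abel_equation F \<and> transforms U f g h E F \<and> x \<in> U \<and> \<theta> = jet_of k E x}"

definition regular_orbit :: "nat \<Rightarrow> jet set \<Rightarrow> bool" where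
  "regular_orbit k Orb \<longleftrightarrow> (\<exists>\<theta>. regular_jet k \<theta> \<and> Orb = jet_orbit k \<theta>)"


section \<open>Smooth curves in the plane\<close>

text \<open>Embedded curves: near each of its points, \<open>S\<close> is the homeomorphic image of an open interval
  under a smooth regular parametrization.\<close>

definition smooth_curve :: "(real \<times> real) set \<Rightarrow> bool" where
  "smooth_curve S \<longleftrightarrow>
     (\<forall>q\<in>S. \<exists>W T \<gamma> \<rho>. open W \<and> q \<in> W \<and> open_interval T \<and>
        smooth_on T (\<lambda>t. fst (\<gamma> t)) \<and> smooth_on T (\<lambda>t. snd (\<gamma> t)) \<and>
        (\<forall>t\<in>T. (deriv (\<lambda>t. fst (\<gamma> t)) t, deriv (\<lambda>t. snd (\<gamma> t)) t) \<noteq> (0, 0)) \<and>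
        homeomorphism T (S \<inter> W) \<gamma> \<rho>)"

text \<open>Near each point of \<open>S\<close>, the function \<open>j\<close> restricts to a chart of \<open>S\<close>: it maps a
  neighbourhood of the point in \<open>S\<close> onto an open set of reals and has a smooth inverse \<open>\<gamma>\<close>.\<close>

definition local_coordinate :: "(real \<times> real) set \<Rightarrow> (real \<times> real \<Rightarrow> real) \<Rightarrow> bool" where
  "local_coordinate S j \<longleftrightarrow>
     (\<forall>q\<in>S. \<exists>W \<gamma>. open W \<and> q \<in> W \<and> open (j ` (S \<inter> W)) \<and>
        smooth_on (j ` (S \<inter> W)) (\<lambda>t. fst (\<gamma> t)) \<and> smooth_on (j ` (S \<inter> W)) (\<lambda>t. snd (\<gamma> t)) \<and>
        (\<forall>r \<in> S \<inter> W. \<gamma> (j r) = r))"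


section \<open>Regularity\<close>

text \<open>
  \<open>\<Delta>\<close> is an interval as in the definition of regularity. The orbit condition is imposed along
  \<open>\<Delta>\<close>, so that \<^term>\<open>s3 E\<close> has no zero there and \<^term>\<open>sigma_map E\<close> is defined on \<open>\<Delta>\<close>. The
  coordinates \<open>j\<^sub>1\<close>, \<open>j\<^sub>1\<^sub>1\<close> of the plane are \<^term>\<open>fst\<close>, \<^term>\<open>snd\<close>.
\<close>

definition regular_interval :: "abel \<Rightarrow> real set \<Rightarrow> bool" where
  "regular_interval E \<Delta> \<longleftrightarrow>
     open_interval \<Delta> \<and> \<Delta> \<subseteq> base E \<and>
     (\<forall>x\<in>\<Delta>. \<exists>Orb. regular_orbit 2 Orb \<and> jet_of 2 E x \<in> Orb) \<and>
     smooth_curve (sigma_map E ` \<Delta>) \<and>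
     (local_coordinate (sigma_map E ` \<Delta>) fst \<or> local_coordinate (sigma_map E ` \<Delta>) snd)"

definition regular_at :: "abel \<Rightarrow> real \<Rightarrow> bool" where
  "regular_at E x \<longleftrightarrow> (\<exists>\<Delta>. x \<in> \<Delta> \<and> regular_interval E \<Delta>)"

text \<open>
  Regularity at every point of the base interval. An equation that is regular at a point \<open>x\<close>
  becomes regular in this sense when it is restricted to the interval \<open>\<Delta>\<close> around \<open>x\<close>.
\<close>

definition regular :: "abel \<Rightarrow> bool" where
  "regular E \<longleftrightarrow> (\<forall>x\<in>base E. regular_at E x)"

end

theory Submission
  imports Defs
begin

text \<open>
  Write \<open>E\<close> and \<open>F\<close> for the two equations and let \<open>f\<close>, \<open>g\<close>, \<open>h\<close> be the components of a point
  transformation from \<open>E\<close> to \<open>F\<close>. Such a transformation exists over an interval precisely if the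
  coefficients of \<open>E\<close> are those of the pullback of \<open>F\<close>
  (\<open>transforms_iff_agree_on_pullback\<close>). By direct computation \<open>s\<^sub>1\<close>, \<open>s\<^sub>3\<close>, \<open>s\<^sub>5\<close> are relative
  invariants: pulling back multiplies them by \<open>f' g\<^sup>2\<close>, \<open>(f' g)\<^sup>3\<close>, \<open>(f' g)\<^sup>5\<close>. In \<open>J\<^sub>1\<close> and
  \<open>\<nabla> J\<^sub>1\<close> these factors cancel, so \<open>\<sigma>\<^sub>E = \<sigma>\<^sub>F \<circ> f\<close>, and equivalent equations have the same
  curve over corresponding small intervals.

  That these small intervals are again regular, and also the converse, rest on one fact about
  regular intervals (\<open>coordinate_deriv_nonzero\<close>): if \<open>j\<close> is a coordinate of the curve, then
  \<open>j \<circ> \<sigma>\<close> has a derivative without zeros. Indeed, the relation between \<open>J\<^sub>1\<close> and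
  \<open>J\<^sub>1\<^sub>1 = s\<^sub>1 s\<^sub>3\<^bsup>-2/3\<^esup> J\<^sub>1'\<close> along the curve is a differential equation for \<open>j \<circ> \<sigma>\<close>. If its
  derivative vanished somewhere, then a uniqueness argument for this equation would make \<open>\<sigma>\<close>
  constant near that point, and by connectedness everywhere; but a point is not a curve.

  For the converse, let the curves be equal. Then \<open>j \<circ> \<sigma>\<^sub>E\<close> and \<open>j \<circ> \<sigma>\<^sub>F\<close> are diffeomorphisms onto
  the same interval and define a change of variable \<open>f\<close> with \<open>\<sigma>\<^sub>E = \<sigma>\<^sub>F \<circ> f\<close>. From the second
  component of this equation \<open>f\<close> is seen to respect \<open>\<nabla>\<close>. There is now exactly enough freedom:
  \<open>g\<close> is determined by the weight of \<open>s\<^sub>3\<close>, \<open>h\<close> by the coefficient \<open>b\<close>, and agreement of \<open>\<nabla>\<close>,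
  \<open>s\<^sub>5\<close> and \<open>s\<^sub>3\<close> yields that of \<open>a\<close>, \<open>c\<close> and \<open>d\<close> in this order
  (\<open>transforms_if_J1_and_nabla_agree\<close>).
\<close>

section \<open>Smooth functions of a real variable\<close>

text \<open>
  Smoothness is a statement about all iterated derivatives at once. Cutting it off at a finite
  order makes closure properties provable by induction: the derivative of a compound function is
  again compound, built from parts that are differentiable one time less.
\<close>

definition differentiable_upto :: "nat \<Rightarrow> real set \<Rightarrow> (real \<Rightarrow> real) \<Rightarrow> bool" where
  "differentiable_upto n U f \<longleftrightarrow> (\<forall>k<n. \<forall>x\<in>U. (deriv ^^ k) f field_differentiable at x)"

lemma differentiable_upto_0 [simp]: "differentiable_upto 0 U f"
  by (simp add: differentiable_upto_def)

lemma differentiable_upto_Suc: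
  "differentiable_upto (Suc n) U f \<longleftrightarrow>
     (\<forall>x\<in>U. f field_differentiable at x) \<and> differentiable_upto n U (deriv f)"
proof -
  have "(deriv ^^ Suc k) f = (deriv ^^ k) (deriv f)" for k
    by (simp only: funpow_Suc_right o_apply)
  then show ?thesis
    unfolding differentiable_upto_def All_less_Suc2 by simp
qed

lemma differentiable_upto_SucD: "differentiable_upto (Suc n) U f \<Longrightarrow> differentiable_upto n U f"
  by (simp add: differentiable_upto_def)

lemma smooth_on_iff_differentiable_upto: "smooth_on U f \<longleftrightarrow> (\<forall>n. differentiable_upto n U f)"
  unfolding smooth_on_def differentiable_upto_def by auto

lemma deriv_cong_open:
  fixes f g :: "real \<Rightarrow> real"
  assumes "open U" "x \<in> U" "\<And>x. x \<in> U \<Longrightarrow> f x = g x"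
  shows "deriv f x = deriv g x"
  using assms by (intro deriv_cong_ev) (auto simp: eventually_nhds)

lemma field_differentiable_cong_open:
  fixes f g :: "real \<Rightarrow> real"
  assumes "open U" "x \<in> U" "\<And>x. x \<in> U \<Longrightarrow> f x = g x" "g field_differentiable at x"
  shows "f field_differentiable at x"
proof -
  have "\<forall>\<^sub>F y in nhds x. f y = g y"
    using assms(1-3) by (auto simp: eventually_nhds)
  then show ?thesis
    using assms(4) DERIV_cong_ev[OF refl _ refl] unfolding field_differentiable_def by blast
qed

lemma differentiable_upto_cong:
  assumes "open U" "\<And>x. x \<in> U \<Longrightarrow> f x = g x" "differentiable_upto n U g"
  shows "differentiable_upto n U f"
  using assms(2,3)
proof (induction n arbitrary: f g)
  case (Suc n)
  have "deriv f x = deriv g x" if "x \<in> U" for x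
    by (rule deriv_cong_open[OF \<open>open U\<close> that Suc.prems(1)])
  moreover have "differentiable_upto n U (deriv g)"
    using Suc.prems(2) by (simp add: differentiable_upto_Suc)
  ultimately have "differentiable_upto n U (deriv f)"
    by (rule Suc.IH)
  moreover have "f field_differentiable at x" if "x \<in> U" for x
    using field_differentiable_cong_open[OF \<open>open U\<close> that Suc.prems(1)] Suc.prems(2) that
    by (simp add: differentiable_upto_Suc)
  ultimately show ?case by (simp add: differentiable_upto_Suc)
qed simp

text \<open>
  The induction step of all the closure properties below. The derivative needs to be known only
  on \<open>U\<close>, hence \<open>U\<close> has to be open for its higher derivatives to be determined there.
\<close>

lemma differentiable_upto_SucI:
  assumes "open U" "\<And>x. x \<in> U \<Longrightarrow> (f has_field_derivative f' x) (at x)"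
    and "differentiable_upto n U f'"
  shows "differentiable_upto (Suc n) U f"
  unfolding differentiable_upto_Suc
proof
  show "\<forall>x\<in>U. f field_differentiable at x"
    using assms(2) by (auto simp: field_differentiable_def)
  show "differentiable_upto n U (deriv f)"
    by (rule differentiable_upto_cong[OF assms(1) _ assms(3)]) (rule DERIV_imp_deriv[OF assms(2)])
qed

lemma differentiable_upto_Suc_DERIV:
  "differentiable_upto (Suc n) U f \<Longrightarrow> x \<in> U \<Longrightarrow> (f has_field_derivative deriv f x) (at x)"
  by (simp add: differentiable_upto_Suc field_differentiable_derivI)

lemma differentiable_upto_Suc_deriv:
  "differentiable_upto (Suc n) U f \<Longrightarrow> differentiable_upto n U (deriv f)"
  by (simp add: differentiable_upto_Suc)

lemma differentiable_upto_const: "open U \<Longrightarrow> differentiable_upto n U (\<lambda>x. c)"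
proof (induction n arbitrary: c)
  case (Suc n)
  show ?case by (rule differentiable_upto_SucI[where f' = "\<lambda>x. 0"]) (use Suc in auto)
qed simp

lemma differentiable_upto_add:
  assumes "open U" "differentiable_upto n U f" "differentiable_upto n U g"
  shows "differentiable_upto n U (\<lambda>x. f x + g x)"
  using assms(2,3)
proof (induction n arbitrary: f g)
  case (Suc n)
  show ?case
    by (rule differentiable_upto_SucI[OF assms(1) DERIV_add Suc.IH])
      (use Suc.prems in \<open>auto intro: differentiable_upto_Suc_DERIV differentiable_upto_Suc_deriv\<close>)
qed simp

lemma differentiable_upto_mult:
  assumes "open U" "differentiable_upto n U f" "differentiable_upto n U g"
  shows "differentiable_upto n U (\<lambda>x. f x * g x)"
  using assms(2,3)
proof (induction n arbitrary: f g)
  case (Suc n)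
  show ?case
    by (rule differentiable_upto_SucI[OF assms(1) DERIV_mult' differentiable_upto_add[OF assms(1)]];
        (rule Suc.IH)?)
      (use Suc.prems in \<open>auto intro: differentiable_upto_Suc_DERIV differentiable_upto_Suc_deriv
         differentiable_upto_SucD\<close>)
qed simp

lemma differentiable_upto_compose:
  assumes "open U" "f ` U \<subseteq> V" "differentiable_upto n U f" "differentiable_upto n V g"
  shows "differentiable_upto n U (\<lambda>x. g (f x))"
  using assms(3,4)
proof (induction n arbitrary: g)
  case (Suc n)
  have "differentiable_upto n U (\<lambda>x. deriv g (f x))"
    by (rule Suc.IH) (use Suc.prems in \<open>auto intro: differentiable_upto_Suc_deriv
         differentiable_upto_SucD\<close>)
  then have "differentiable_upto n U (\<lambda>x. deriv g (f x) * deriv f x)"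
    by (rule differentiable_upto_mult[OF assms(1)])
      (rule differentiable_upto_Suc_deriv[OF Suc.prems(1)])
  then show ?case
    by (rule differentiable_upto_SucI[OF assms(1) DERIV_chain2, rotated 2])
      (use assms(2) Suc.prems in \<open>auto intro: differentiable_upto_Suc_DERIV\<close>)
qed simp

lemma differentiable_upto_inverse:
  assumes "open U" "differentiable_upto n U f" "\<And>x. x \<in> U \<Longrightarrow> f x \<noteq> 0"
  shows "differentiable_upto n U (\<lambda>x. inverse (f x))"
  using assms(2)
proof (induction n)
  case (Suc n)
  have IH: "differentiable_upto n U (\<lambda>x. inverse (f x))"
    by (rule Suc.IH) (rule differentiable_upto_SucD[OF Suc.prems])
  have D: "differentiable_upto n U (\<lambda>x. (-1) * (inverse (f x) * deriv f x * inverse (f x)))"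
    by (intro differentiable_upto_mult differentiable_upto_const assms(1) IH
        differentiable_upto_Suc_deriv[OF Suc.prems])
  show ?case
  proof (rule differentiable_upto_SucI[OF assms(1) _ D])
    fix x assume "x \<in> U"
    then show "((\<lambda>x. inverse (f x)) has_field_derivative
        (-1) * (inverse (f x) * deriv f x * inverse (f x))) (at x)"
      using DERIV_inverse'[OF differentiable_upto_Suc_DERIV[OF Suc.prems] assms(3)] by simp
  qed
qed simp

lemma differentiable_upto_root3: "differentiable_upto n {x. x \<noteq> 0} (root 3)"
proof (induction n)
  case (Suc n)
  have op: "open {x::real. x \<noteq> 0}"
    by (rule open_Collect_neq) (auto intro: continuous_intros)
  show ?case
  proof (rule differentiable_upto_SucI[OF op])
    show "differentiable_upto n {x. x \<noteq> 0} (\<lambda>x. inverse (3 * (root 3 x * root 3 x)))"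
      by (intro differentiable_upto_mult differentiable_upto_const differentiable_upto_inverse op
          Suc.IH) auto
    show "(root 3 has_field_derivative inverse (3 * (root 3 x * root 3 x))) (at x)"
      if "x \<in> {x. x \<noteq> 0}" for x
      using DERIV_odd_real_root[of 3 x] that by (simp add: power2_eq_square)
  qed
qed simp

lemma differentiable_upto_inverse_function:
  assumes "open U" "open V" "v ` V \<subseteq> U" "smooth_on U w" "\<And>x. x \<in> U \<Longrightarrow> deriv w x \<noteq> 0"
    and D: "\<And>y. y \<in> V \<Longrightarrow> (v has_field_derivative inverse (deriv w (v y))) (at y)"
  shows "differentiable_upto n V v"
proof (induction n)
  case (Suc n)
  have "differentiable_upto (Suc n) U w"
    using assms(4) by (simp add: smooth_on_iff_differentiable_upto)
  then have "differentiable_upto n U (deriv w)"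
    by (rule differentiable_upto_Suc_deriv)
  then have "differentiable_upto n V (\<lambda>y. deriv w (v y))"
    by (rule differentiable_upto_compose[OF assms(2,3) Suc.IH])
  then have "differentiable_upto n V (\<lambda>y. inverse (deriv w (v y)))"
    by (rule differentiable_upto_inverse[OF assms(2)]) (use assms(3,5) in auto)
  then show ?case
    using differentiable_upto_SucI[OF assms(2) D] by blast
qed simp

lemma smooth_on_subset: "smooth_on U f \<Longrightarrow> V \<subseteq> U \<Longrightarrow> smooth_on V f"
  by (auto simp: smooth_on_def)

lemma smooth_on_deriv: "smooth_on U f \<Longrightarrow> smooth_on U (deriv f)"
  by (simp add: smooth_on_iff_differentiable_upto differentiable_upto_Suc_deriv)

lemma smooth_on_DERIV: "smooth_on U f \<Longrightarrow> x \<in> U \<Longrightarrow> (f has_field_derivative deriv f x) (at x)"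
  by (metis differentiable_upto_Suc_DERIV smooth_on_iff_differentiable_upto)

lemma smooth_on_imp_continuous_on: "smooth_on U f \<Longrightarrow> continuous_on U f"
  by (meson DERIV_continuous_on has_field_derivative_at_within smooth_on_DERIV)

lemma smooth_on_imp_isCont: "smooth_on U f \<Longrightarrow> x \<in> U \<Longrightarrow> isCont f x"
  using DERIV_isCont smooth_on_DERIV by blast

lemma smooth_on_const: "open U \<Longrightarrow> smooth_on U (\<lambda>x. c)"
  by (simp add: smooth_on_iff_differentiable_upto differentiable_upto_const)

lemma smooth_on_add:
  "open U \<Longrightarrow> smooth_on U f \<Longrightarrow> smooth_on U g \<Longrightarrow> smooth_on U (\<lambda>x. f x + g x)"
  by (simp add: smooth_on_iff_differentiable_upto differentiable_upto_add)

lemma smooth_on_mult: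
  "open U \<Longrightarrow> smooth_on U f \<Longrightarrow> smooth_on U g \<Longrightarrow> smooth_on U (\<lambda>x. f x * g x)"
  by (simp add: smooth_on_iff_differentiable_upto differentiable_upto_mult)

lemma smooth_on_diff:
  assumes "open U" "smooth_on U f" "smooth_on U g"
  shows "smooth_on U (\<lambda>x. f x - g x)"
  using smooth_on_add[OF assms(1,2) smooth_on_mult[OF assms(1) smooth_on_const[OF assms(1), of "-1"] assms(3)]]
  by simp

lemma smooth_on_power: "open U \<Longrightarrow> smooth_on U f \<Longrightarrow> smooth_on U (\<lambda>x. f x ^ n)"
  by (induction n) (auto intro: smooth_on_const smooth_on_mult)

lemma smooth_on_divide:
  assumes "open U" "smooth_on U f" "smooth_on U g" "\<And>x. x \<in> U \<Longrightarrow> g x \<noteq> 0"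
  shows "smooth_on U (\<lambda>x. f x / g x)"
  using smooth_on_mult[OF assms(1,2), of "\<lambda>x. inverse (g x)"] differentiable_upto_inverse[of U _ g] assms
  by (simp add: smooth_on_iff_differentiable_upto divide_inverse)

lemma smooth_on_compose:
  "open U \<Longrightarrow> smooth_on U f \<Longrightarrow> smooth_on V g \<Longrightarrow> f ` U \<subseteq> V \<Longrightarrow> smooth_on U (\<lambda>x. g (f x))"
  unfolding smooth_on_iff_differentiable_upto using differentiable_upto_compose by blast

lemma smooth_on_root3:
  assumes "open U" "smooth_on U f" "\<And>x. x \<in> U \<Longrightarrow> f x \<noteq> 0"
  shows "smooth_on U (\<lambda>x. root 3 (f x))"
proof (rule smooth_on_compose[OF assms(1,2)])
  show "smooth_on {x. x \<noteq> 0} (root 3)"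
    by (simp add: smooth_on_iff_differentiable_upto differentiable_upto_root3)
qed (use assms(3) in auto)

lemmas smooth_intros =
  smooth_on_const smooth_on_add smooth_on_diff smooth_on_mult smooth_on_power smooth_on_divide
  smooth_on_deriv smooth_on_root3

section \<open>Inverse functions\<close>

text \<open>
  By the mean value theorem two points with the same value would enclose a zero of the derivative.
\<close>

lemma deriv_nonzero_imp_inj_on:
  assumes "open_interval U" "smooth_on U w" "\<And>x. x \<in> U \<Longrightarrow> deriv w x \<noteq> 0"
  shows "inj_on w U"
proof (rule linorder_inj_onI')
  fix x y assume xy: "x \<in> U" "y \<in> U" "x < y"
  have U: "{x..y} \<subseteq> U"
  proof
    fix z assume "z \<in> {x..y}"
    then show "z \<in> U"
      using mem_is_interval_1_I[of U x y z] assms(1) xy by (simp add: open_interval_def)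
  qed
  have D: "(w has_field_derivative deriv w z) (at z)" if "x \<le> z" "z \<le> y" for z
    using smooth_on_DERIV[OF assms(2), of z] U that by auto
  show "w x \<noteq> w y"
  proof
    assume eq: "w x = w y"
    obtain z where z: "x < z" "z < y" "w y - w x = (y - x) * deriv w z"
      using MVT2[OF xy(3) D] by blast
    moreover have "z \<in> U" using U z by auto
    ultimately show False using assms(3) eq xy by auto
  qed
qed

text \<open>
  On an interval a nonvanishing derivative gives a global inverse. Its derivative
  \<open>1 / (w' \<circ> v)\<close> is an expression in \<open>v\<close> itself, so every order of differentiability
  of the inverse \<open>v\<close> yields the next one.
\<close>

lemma smooth_inverse_function:
  assumes "open_interval U" "smooth_on U w" "\<And>x. x \<in> U \<Longrightarrow> deriv w x \<noteq> 0"
  shows "inj_on w U" "open_interval (w ` U)" "smooth_on (w ` U) (inv_into U w)"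
proof -
  have U: "open U" "is_interval U" "U \<noteq> {}" using assms(1) by (auto simp: open_interval_def)
  have cw: "continuous_on U w" by (rule smooth_on_imp_continuous_on[OF assms(2)])
  show inj: "inj_on w U" by (rule deriv_nonzero_imp_inj_on[OF assms])
  have op: "open (w ` U)" by (rule injective_into_1d_imp_open_map_UNIV[OF U(1) cw inj order_refl])
  have "connected (w ` U)"
    using connected_continuous_image[OF cw] U(2) is_interval_connected_1 by blast
  then show "open_interval (w ` U)"
    using op U(3) by (auto simp: open_interval_def is_interval_connected_1)
  have "continuous_on (w ` U) (inv_into U w)"
    by (rule continuous_on_inverse_open[OF U(1) cw]) (auto simp: inj)
  then have ci: "isCont (inv_into U w) y" if "y \<in> w ` U" for y
    using that continuous_on_eq_continuous_at[OF op] by blast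
  have D: "(inv_into U w has_field_derivative inverse (deriv w (inv_into U w y))) (at y)"
    if y: "y \<in> w ` U" for y
  proof (rule has_field_derivative_inverse_basic[OF _ _ _ op y])
    show "(w has_field_derivative deriv w (inv_into U w y)) (at (inv_into U w y))"
      using smooth_on_DERIV[OF assms(2)] y inv_into_into by metis
  qed (use assms(3) y ci in \<open>auto simp: inv_into_into f_inv_into_f\<close>)
  have "inv_into U w ` (w ` U) \<subseteq> U" by (auto simp: inj)
  then show "smooth_on (w ` U) (inv_into U w)"
    using differentiable_upto_inverse_function[OF U(1) op _ assms(2,3) D]
    by (simp add: smooth_on_iff_differentiable_upto)
qed

section \<open>Pulling back an Abel equation\<close>

text \<open>
  The coefficients of the equation whose solutions \<open>y(x)\<close> are those for which
  \<open>g y + h\<close>, read as a function of \<open>f(x)\<close>, solves \<open>F\<close>: expand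
  \<open>g' y + g y' + h' = f' (a (g y + h)\<^sup>3 + b (g y + h)\<^sup>2 + c (g y + h) + d)\<close> in powers of \<open>y\<close>
  and divide by \<open>g\<close>, where \<open>a, b, c, d\<close> are the coefficients of \<open>F\<close> at \<open>f(x)\<close>.
\<close>

definition pullback ::
    "real set \<Rightarrow> (real \<Rightarrow> real) \<Rightarrow> (real \<Rightarrow> real) \<Rightarrow> (real \<Rightarrow> real) \<Rightarrow> abel \<Rightarrow> abel" where
  "pullback U f g h F =
     \<lparr>base = U,
      ca = (\<lambda>x. deriv f x * ca F (f x) * g x ^ 2),
      cb = (\<lambda>x. deriv f x * g x * (3 * ca F (f x) * h x + cb F (f x))),
      cc = (\<lambda>x. deriv f x * (3 * ca F (f x) * h x ^ 2 + 2 * cb F (f x) * h x + cc F (f x))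
                 - deriv g x / g x),
      cd = (\<lambda>x. (deriv f x * (ca F (f x) * h x ^ 3 + cb F (f x) * h x ^ 2 + cc F (f x) * h x + cd F (f x))
                 - deriv h x) / g x)\<rparr>"

definition agree_on :: "real set \<Rightarrow> abel \<Rightarrow> abel \<Rightarrow> bool" where
  "agree_on U E E' \<longleftrightarrow>
     (\<forall>x\<in>U. ca E x = ca E' x \<and> cb E x = cb E' x \<and> cc E x = cc E' x \<and> cd E x = cd E' x)"

lemma cubic_coefficients_unique:
  fixes a b c d a' b' c' d' :: real
  assumes "\<And>y. a * y ^ 3 + b * y ^ 2 + c * y + d = a' * y ^ 3 + b' * y ^ 2 + c' * y + d'"
  shows "a = a' \<and> b = b' \<and> c = c' \<and> d = d'"
  using assms[of 0] assms[of 1] assms[of "-1"] assms[of 2] by auto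

lemma rhs_pullback:
  assumes "g x \<noteq> 0"
  shows "rhs (pullback U f g h F) x y =
    (deriv f x * rhs F (f x) (g x * y + h x) - deriv g x * y - deriv h x) / g x"
  using assms unfolding rhs_def pullback_def
  by (simp add: field_simps power2_eq_square power3_eq_cube)

text \<open>
  For nonzero \<open>f'\<close> and \<open>g\<close> the prolongation condition can be solved for \<open>p\<close>; it then says that
  the right-hand sides of \<open>E\<close> and of the pullback are the same cubic polynomials in \<open>y\<close>.
\<close>

lemma transforms_iff_agree_on_pullback:
  assumes "point_transformation U f g h" "U \<subseteq> base E" "f ` U \<subseteq> base F"
  shows "transforms U f g h E F \<longleftrightarrow> agree_on U E (pullback U f g h F)"
proof -
  have eq: "(\<forall>y p. p = rhs E x y \<longleftrightarrow>
        (deriv g x * y + g x * p + deriv h x) / deriv f x = rhs F (f x) (g x * y + h x)) \<longleftrightarrow>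
      ca E x = ca P x \<and> cb E x = cb P x \<and> cc E x = cc P x \<and> cd E x = cd P x"
    if x: "x \<in> U" and P: "P = pullback U f g h F" for x P
  proof -
    have nz: "deriv f x \<noteq> 0" "g x \<noteq> 0" using assms(1) x by (auto simp: point_transformation_def)
    have "((deriv g x * y + g x * p + deriv h x) / deriv f x = rhs F (f x) (g x * y + h x)) \<longleftrightarrow>
        p = rhs P x y" for y p
      unfolding P rhs_pullback[of g x, OF nz(2)] using nz by (auto simp: field_simps)
    then have "(\<forall>y p. p = rhs E x y \<longleftrightarrow>
        (deriv g x * y + g x * p + deriv h x) / deriv f x = rhs F (f x) (g x * y + h x)) \<longleftrightarrow>
        (\<forall>y. rhs E x y = rhs P x y)"
      by auto
    also have "\<dots> \<longleftrightarrow> ca E x = ca P x \<and> cb E x = cb P x \<and> cc E x = cc P x \<and> cd E x = cd P x"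
      unfolding rhs_def by (auto intro!: cubic_coefficients_unique)
    finally show ?thesis .
  qed
  then show ?thesis
    using assms unfolding transforms_def agree_on_def by simp
qed

section \<open>Relative and absolute invariants\<close>

lemma
  assumes "abel_equation E"
  shows smooth_on_s3: "smooth_on (base E) (s3 E)"
    and smooth_on_s5: "smooth_on (base E) (s5 E)"
proof -
  have op: "open (base E)" and *: "smooth_on (base E) (ca E)" "smooth_on (base E) (cb E)"
    "smooth_on (base E) (cc E)" "smooth_on (base E) (cd E)"
    using assms by (auto simp: abel_equation_def open_interval_def)
  have "smooth_on (base E) (\<lambda>x. s3 E x)"
    unfolding s3_def by (intro smooth_intros op *)
  then show s3: "smooth_on (base E) (s3 E)" by simp
  have "smooth_on (base E) (\<lambda>x. s5 E x)"
    unfolding s5_def by (intro smooth_intros op * s3)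
  then show "smooth_on (base E) (s5 E)" by simp
qed

lemma
  assumes "abel_equation E" "open U" "U \<subseteq> base E" "\<And>x. x \<in> U \<Longrightarrow> s3 E x \<noteq> 0"
  shows smooth_on_J1: "smooth_on U (J1 E)"
    and smooth_on_J11: "smooth_on U (J11 E)"
proof -
  have *: "smooth_on U (ca E)" "smooth_on U (s3 E)" "smooth_on U (s5 E)"
    using assms smooth_on_s3 smooth_on_s5 smooth_on_subset abel_equation_def by blast+
  have "smooth_on U (\<lambda>x. J1 E x)"
    unfolding J1_def using assms(4) by (intro smooth_intros assms(2) *) auto
  then show J1: "smooth_on U (J1 E)" by simp
  have "smooth_on U (\<lambda>x. J11 E x)"
    unfolding J11_def s1_def using assms(4) by (intro smooth_intros assms(2) * J1) auto
  then show "smooth_on U (J11 E)" by simp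
qed

text \<open>
  The invariants are differential expressions in the coefficients, so agreement at the single
  point \<open>x\<close> would not suffice; on an open set it passes to the derivatives.
\<close>

lemma
  assumes "open U" "agree_on U E E'" "x \<in> U"
  shows s3_cong: "s3 E x = s3 E' x"
    and J1_cong: "J1 E x = J1 E' x"
    and J11_cong: "J11 E x = J11 E' x"
proof -
  have eq: "ca E x = ca E' x" "cb E x = cb E' x" "cc E x = cc E' x" "cd E x = cd E' x" if "x \<in> U" for x
    using assms(2) that by (auto simp: agree_on_def)
  have d: "deriv (ca E) x = deriv (ca E') x" "deriv (cb E) x = deriv (cb E') x" if "x \<in> U" for x
    using deriv_cong_open[OF assms(1) that] eq by blast+
  have s3: "s3 E x = s3 E' x" if "x \<in> U" for x
    using that by (simp add: s3_def d eq)
  have d3: "deriv (s3 E) x = deriv (s3 E') x" if "x \<in> U" for x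
    by (rule deriv_cong_open[OF assms(1) that s3])
  have s5: "s5 E x = s5 E' x" if "x \<in> U" for x
    using that by (simp add: s5_def s3 d3 d eq)
  have J1: "J1 E x = J1 E' x" if "x \<in> U" for x
    using that by (simp add: J1_def s3 s5)
  have dJ: "deriv (J1 E) x = deriv (J1 E') x" if "x \<in> U" for x
    by (rule deriv_cong_open[OF assms(1) that J1])
  show "s3 E x = s3 E' x" "J1 E x = J1 E' x" "J11 E x = J11 E' x"
    using assms(3) by (simp_all add: s3 J1 J11_def s1_def dJ eq)
qed

text \<open>
  The functions \<open>a\<close>, \<open>b\<close>, \<open>s\<^sub>3\<close>, \<open>s\<^sub>5\<close> can serve as coordinates instead of \<open>a\<close>, \<open>b\<close>, \<open>c\<close>, \<open>d\<close>:
  \<open>c\<close> enters \<open>s\<^sub>5\<close> linearly with the factor \<open>-3 a s\<^sub>3\<close>, and once \<open>c\<close> is known, \<open>d\<close> enters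
  \<open>s\<^sub>3\<close> linearly with the factor \<open>-3 a\<^sup>2\<close>. Both factors are nonzero.
\<close>

lemma agree_on_if_invariants_agree:
  assumes "open U"
    and a: "\<And>x. x \<in> U \<Longrightarrow> ca E x = ca E' x" and "\<And>x. x \<in> U \<Longrightarrow> ca E x \<noteq> 0"
    and b: "\<And>x. x \<in> U \<Longrightarrow> cb E x = cb E' x"
    and s3: "\<And>x. x \<in> U \<Longrightarrow> s3 E x = s3 E' x" and "\<And>x. x \<in> U \<Longrightarrow> s3 E x \<noteq> 0"
    and s5: "\<And>x. x \<in> U \<Longrightarrow> s5 E x = s5 E' x"
  shows "agree_on U E E'"
  unfolding agree_on_def
proof
  fix x assume x: "x \<in> U"
  have d: "deriv (ca E) x = deriv (ca E') x" "deriv (cb E) x = deriv (cb E') x"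
      "deriv (s3 E) x = deriv (s3 E') x"
    using deriv_cong_open[OF assms(1) x] a b s3 by blast+
  have nz: "ca E' x \<noteq> 0" "s3 E' x \<noteq> 0" using assms(3,6)[OF x] a s3 x by auto
  have c: "cc E x = cc E' x"
    using s5[OF x] nz unfolding s5_def by (simp add: a[OF x] b[OF x] s3[OF x] d)
  have "cd E x = cd E' x"
    using s3[OF x] nz unfolding s3_def by (simp add: a[OF x] b[OF x] c d)
  then show "ca E x = ca E' x \<and> cb E x = cb E' x \<and> cc E x = cc E' x \<and> cd E x = cd E' x"
    using a[OF x] b[OF x] c by simp
qed

text \<open>
  Both expressions are relative invariants of weight a power of \<open>f' g\<close>. The second law follows from
  the first: differentiating the weight \<open>(f' g)\<^sup>3\<close> produces exactly the terms by which
  \<open>3 s\<^sub>3 (a' + a c - b\<^sup>2 / 3)\<close> fails to be a relative invariant.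
\<close>

lemma
  assumes F: "abel_equation F" and pt: "point_transformation U f g h" and sub: "f ` U \<subseteq> base F"
    and x: "x \<in> U"
  shows s3_pullback: "s3 (pullback U f g h F) x = (deriv f x * g x) ^ 3 * s3 F (f x)" (is ?s3)
    and s5_pullback: "s5 (pullback U f g h F) x = (deriv f x * g x) ^ 5 * s5 F (f x)" (is ?s5)
proof -
  define P where "P = pullback U f g h F"
  have U: "open U" and sm: "smooth_on U f" "smooth_on U g" "smooth_on U h"
    and nz: "\<And>x. x \<in> U \<Longrightarrow> deriv f x \<noteq> 0" "\<And>x. x \<in> U \<Longrightarrow> g x \<noteq> 0"
    using pt by (auto simp: point_transformation_def open_interval_def)
  have smF: "smooth_on (base F) (ca F)" "smooth_on (base F) (cb F)"
    using F by (auto simp: abel_equation_def)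
  note Df = smooth_on_DERIV[OF sm(1)] and Dg = smooth_on_DERIV[OF sm(2)]
    and Dh = smooth_on_DERIV[OF sm(3)] and Df' = smooth_on_DERIV[OF smooth_on_deriv[OF sm(1)]]
  have DF: "((\<lambda>x. u (f x)) has_field_derivative deriv u (f x) * deriv f x) (at x)"
    if "smooth_on (base F) u" "x \<in> U" for u x
    using DERIV_chain2[OF smooth_on_DERIV[OF that(1)] Df[OF that(2)]] sub that(2) by auto
  have da: "deriv (ca P) x = deriv (deriv f) x * ca F (f x) * g x ^ 2
      + deriv f x * (deriv (ca F) (f x) * deriv f x) * g x ^ 2
      + deriv f x * ca F (f x) * (2 * g x * deriv g x)" if x: "x \<in> U" for x
    unfolding P_def pullback_def abel.simps
    by (rule DERIV_imp_deriv)
      (rule derivative_eq_intros Df[OF x] Dg[OF x] Df'[OF x] DF[OF smF(1) x] refl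
        | simp add: algebra_simps)+
  have db: "deriv (cb P) x =
      (deriv (deriv f) x * g x + deriv f x * deriv g x) * (3 * ca F (f x) * h x + cb F (f x))
      + deriv f x * g x * (3 * (deriv (ca F) (f x) * deriv f x * h x + ca F (f x) * deriv h x)
          + deriv (cb F) (f x) * deriv f x)" if x: "x \<in> U" for x
    unfolding P_def pullback_def abel.simps
    by (rule DERIV_imp_deriv)
      (rule derivative_eq_intros Df[OF x] Dg[OF x] Dh[OF x] Df'[OF x] DF[OF smF(1) x] DF[OF smF(2) x] refl
        | simp add: algebra_simps)+
  have s3P: "s3 P x = (deriv f x * g x) ^ 3 * s3 F (f x)" if x: "x \<in> U" for x
  proof -
    show ?thesis
      unfolding s3_def da[OF x] db[OF x]
      unfolding P_def pullback_def abel.simps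
      using nz(2)[OF x]
      by (simp add: field_simps power2_eq_square power3_eq_cube)
  qed
  show ?s3 using s3P[OF x] by (simp add: P_def)
  have "deriv (s3 P) x = deriv (\<lambda>x. (deriv f x * g x) ^ 3 * s3 F (f x)) x"
    by (rule deriv_cong_open[OF U x s3P])
  also have "\<dots> = 3 * (deriv f x * g x) ^ 2 * (deriv (deriv f) x * g x + deriv f x * deriv g x) * s3 F (f x)
      + (deriv f x * g x) ^ 3 * (deriv (s3 F) (f x) * deriv f x)"
    by (rule DERIV_imp_deriv)
      (rule derivative_eq_intros Df'[OF x] Dg[OF x] DF[OF smooth_on_s3[OF F] x] refl
        | simp add: algebra_simps)+
  finally have d3: "deriv (s3 P) x = \<dots>" .
  have "s5 P x = (deriv f x * g x) ^ 5 * s5 F (f x)"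
    unfolding s5_def d3 da[OF x] s3P[OF x]
    unfolding P_def pullback_def abel.simps
    using nz(2)[OF x]
    by (simp add: field_simps power2_eq_square eval_nat_numeral)
  then show ?s5 by (simp add: P_def)
qed

text \<open>
  The weights \<open>(f' g)\<^sup>1\<^sup>5\<close> of numerator and denominator of \<open>J\<^sub>1\<close> cancel. The coefficient
  \<open>s\<^sub>1 / s\<^sub>3\<^bsup>2/3\<^esup>\<close> has weight \<open>f' g\<^sup>2 / (f' g)\<^sup>2 = 1 / f'\<close>, which cancels the factor \<open>f'\<close>
  that the chain rule contributes to the derivative of \<open>J\<^sub>1\<close>.
\<close>

lemma
  assumes F: "abel_equation F" and pt: "point_transformation U f g h" and sub: "f ` U \<subseteq> base F"
    and nz: "\<And>x. x \<in> U \<Longrightarrow> s3 F (f x) \<noteq> 0" and x: "x \<in> U"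
  shows J1_pullback: "J1 (pullback U f g h F) x = J1 F (f x)" (is ?J1)
    and J11_pullback: "J11 (pullback U f g h F) x = J11 F (f x)" (is ?J11)
proof -
  define P where "P = pullback U f g h F"
  have U: "open U" and sm: "smooth_on U f"
    and fg: "\<And>x. x \<in> U \<Longrightarrow> deriv f x \<noteq> 0" "\<And>x. x \<in> U \<Longrightarrow> g x \<noteq> 0"
    using pt by (auto simp: point_transformation_def open_interval_def)
  have s3: "s3 P x = (deriv f x * g x) ^ 3 * s3 F (f x)" and s5: "s5 P x = (deriv f x * g x) ^ 5 * s5 F (f x)"
    if "x \<in> U" for x
    unfolding P_def using s3_pullback[OF F pt sub that] s5_pullback[OF F pt sub that] by auto
  have J1: "J1 P x = J1 F (f x)" if "x \<in> U" for x
    unfolding J1_def s3[OF that] s5[OF that] using fg[OF that]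
    by (simp add: power_mult_distrib flip: power_mult)
  show ?J1 using J1[OF x] by (simp add: P_def)
  define V where "V = base F \<inter> s3 F -` (- {0})"
  have opF: "open (base F)" using F by (auto simp: abel_equation_def open_interval_def)
  have V: "open V"
    unfolding V_def
    by (rule continuous_open_preimage[OF smooth_on_imp_continuous_on[OF smooth_on_s3[OF F]] opF]) auto
  have J1F: "smooth_on V (J1 F)"
    by (rule smooth_on_J1[OF F V]) (auto simp: V_def)
  have "f x \<in> V" using sub nz[OF x] x by (auto simp: V_def)
  then have "((\<lambda>x. J1 F (f x)) has_field_derivative deriv (J1 F) (f x) * deriv f x) (at x)"
    by (intro DERIV_chain2 smooth_on_DERIV[OF J1F] smooth_on_DERIV[OF sm x])
  then have d: "deriv (J1 P) x = deriv (J1 F) (f x) * deriv f x"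
    using deriv_cong_open[OF U x J1] by (auto dest: DERIV_imp_deriv)
  have r: "root 3 (s3 P x) = (deriv f x * g x) * root 3 (s3 F (f x))"
    unfolding s3[OF x] real_root_mult by (simp add: odd_real_root_power_cancel)
  have "root 3 (s3 F (f x)) \<noteq> 0" using nz[OF x] by simp
  then have "J11 P x = J11 F (f x)"
    unfolding J11_def d r s1_def using fg[OF x]
    unfolding P_def pullback_def abel.simps by (simp add: field_simps power2_eq_square)
  then show ?J11 by (simp add: P_def)
qed

lemma sigma_map_eq_if_transforms:
  assumes "abel_equation F" "transforms U f g h E F" "\<And>x. x \<in> U \<Longrightarrow> s3 F (f x) \<noteq> 0" "x \<in> U"
  shows "sigma_map E x = sigma_map F (f x)"
proof -
  have pt: "point_transformation U f g h" and sub: "U \<subseteq> base E" "f ` U \<subseteq> base F"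
    using assms(2) by (auto simp: transforms_def)
  have U: "open U" using pt by (auto simp: point_transformation_def open_interval_def)
  have ag: "agree_on U E (pullback U f g h F)"
    using transforms_iff_agree_on_pullback[OF pt sub] assms(2) by simp
  show ?thesis
    unfolding sigma_map_def J1_cong[OF U ag assms(4)] J11_cong[OF U ag assms(4)]
    by (simp add: J1_pullback[OF assms(1) pt sub(2) assms(3,4)]
        J11_pullback[OF assms(1) pt sub(2) assms(3,4)])
qed

lemma s3_transforms:
  assumes "abel_equation F" "transforms U f g h E F" "x \<in> U"
  shows "s3 E x = (deriv f x * g x) ^ 3 * s3 F (f x)"
proof -
  have pt: "point_transformation U f g h" and sub: "U \<subseteq> base E" "f ` U \<subseteq> base F"
    using assms(2) by (auto simp: transforms_def)
  have U: "open U" using pt by (auto simp: point_transformation_def open_interval_def)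
  have ag: "agree_on U E (pullback U f g h F)"
    using transforms_iff_agree_on_pullback[OF pt sub] assms(2) by simp
  show ?thesis
    unfolding s3_cong[OF U ag assms(3)] by (rule s3_pullback[OF assms(1) pt sub(2) assms(3)])
qed

section \<open>Reconstructing a transformation\<close>

text \<open>
  Given the change \<open>f\<close> of the independent variable, \<open>g\<close> and \<open>h\<close> can be solved for. The
  weight \<open>(f' g)\<^sup>3\<close> of \<open>s\<^sub>3\<close> dictates \<open>g\<close>, and then \<open>h\<close> is chosen to make \<open>b\<close> agree.
  Agreement of \<open>\<nabla>\<close> gives agreement of \<open>a\<close>; agreement of \<open>J\<^sub>1\<close> gives agreement of \<open>s\<^sub>5\<^sup>3\<close>, hence of
  \<open>s\<^sub>5\<close>. The remaining coefficients \<open>c\<close> and \<open>d\<close> are then determined.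
\<close>

lemma transforms_if_J1_and_nabla_agree:
  assumes E: "abel_equation E" and F: "abel_equation F"
    and U: "open_interval U" "U \<subseteq> base E" and f: "smooth_on U f" "f ` U \<subseteq> base F"
    and f': "\<And>x. x \<in> U \<Longrightarrow> deriv f x \<noteq> 0"
    and nzE: "\<And>x. x \<in> U \<Longrightarrow> s3 E x \<noteq> 0" and nzF: "\<And>x. x \<in> U \<Longrightarrow> s3 F (f x) \<noteq> 0"
    and J1: "\<And>x. x \<in> U \<Longrightarrow> J1 E x = J1 F (f x)"
    and nabla: "\<And>x. x \<in> U \<Longrightarrow>
      s1 E x / (root 3 (s3 E x)) ^ 2 * deriv f x = s1 F (f x) / (root 3 (s3 F (f x))) ^ 2"
  shows "\<exists>g h. transforms U f g h E F"
proof -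
  define g where "g x = root 3 (s3 E x) / (root 3 (s3 F (f x)) * deriv f x)" for x
  define h where "h x = (cb E x / (deriv f x * g x) - cb F (f x)) / (3 * ca F (f x))" for x
  define P where "P = pullback U f g h F"
  have op: "open U" using U(1) by (simp add: open_interval_def)
  have aE: "ca E x \<noteq> 0" and aF: "ca F (f x) \<noteq> 0" if "x \<in> U" for x
    using E F U(2) f(2) that by (auto simp: abel_equation_def)
  have g0: "g x \<noteq> 0" if "x \<in> U" for x
    using f' nzE nzF that by (auto simp: g_def)
  have smE: "smooth_on U (cb E)" "smooth_on U (s3 E)"
    using E smooth_on_s3[OF E] U(2) smooth_on_subset unfolding abel_equation_def by blast+
  have smF: "smooth_on U (\<lambda>x. ca F (f x))" "smooth_on U (\<lambda>x. cb F (f x))" "smooth_on U (\<lambda>x. s3 F (f x))"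
    using F smooth_on_s3[OF F] smooth_on_compose[OF op f(1) _ f(2)] unfolding abel_equation_def by blast+
  have "smooth_on U (\<lambda>x. g x)"
    unfolding g_def using nzE nzF f' by (intro smooth_intros op smE smF f(1)) auto
  then have g: "smooth_on U g" by simp
  have "smooth_on U (\<lambda>x. h x)"
    unfolding h_def using g0 f' aF by (intro smooth_intros op smE smF f(1) g) auto
  then have h: "smooth_on U h" by simp
  have pt: "point_transformation U f g h"
    using U(1) f(1) g h f' g0 by (simp add: point_transformation_def)
  have ca: "ca E x = ca P x" if x: "x \<in> U" for x
  proof -
    have "root 3 (s3 E x) \<noteq> 0" "root 3 (s3 F (f x)) \<noteq> 0" using nzE[OF x] nzF[OF x] by auto
    then show ?thesis
      using nabla[OF x] f'[OF x] unfolding P_def pullback_def abel.simps g_def s1_def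
      by (simp add: field_simps power2_eq_square)
  qed
  have cb: "cb E x = cb P x" if x: "x \<in> U" for x
    using f'[OF x] g0[OF x] aF[OF x] unfolding P_def pullback_def abel.simps h_def
    by (simp add: field_simps)
  have weight: "(deriv f x * g x) ^ 3 = s3 E x / s3 F (f x)" if x: "x \<in> U" for x
  proof -
    have "deriv f x * g x = root 3 (s3 E x) / root 3 (s3 F (f x))"
      using f'[OF x] by (simp add: g_def)
    then show ?thesis by (simp add: power_divide odd_real_root_pow)
  qed
  have s3: "s3 E x = s3 P x" if x: "x \<in> U" for x
    unfolding P_def s3_pullback[OF F pt f(2) x] weight[OF x] using nzF[OF x] by simp
  have s5: "s5 E x = s5 P x" if x: "x \<in> U" for x
  proof -
    have "J1 E x = J1 P x"
      unfolding P_def using J1_pullback[OF F pt f(2) nzF x] J1[OF x] by simp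
    then have "s5 E x ^ 3 = s5 P x ^ 3"
      using nzE[OF x] s3[OF x] by (simp add: J1_def)
    then show ?thesis
      by (metis odd_real_root_power_cancel odd_numeral)
  qed
  have "agree_on U E P"
    by (rule agree_on_if_invariants_agree[OF op ca aE cb s3 nzE s5])
  then have "transforms U f g h E F"
    using transforms_iff_agree_on_pullback[OF pt U(2) f(2)] by (simp add: P_def)
  then show ?thesis by blast
qed

section \<open>Orbits of regular jets\<close>

lemma s3_eq_if_jets_eq:
  assumes "jet_of 2 E x = jet_of 2 E' x'"
  shows "s3 E x = s3 E' x'"
proof -
  have "x = x'" "ca E x = ca E' x'" "cb E x = cb E' x'" "cc E x = cc E' x'" "cd E x = cd E' x'"
    "deriv (ca E) x = deriv (ca E') x'" "deriv (cb E) x = deriv (cb E') x'"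
    using assms by (auto simp: jet_of_def upt_rec numeral_2_eq_2)
  then show ?thesis unfolding s3_def by simp
qed

text \<open>
  The value of \<open>s\<^sub>3\<close> at a point depends only on a jet of the coefficients there, and transformations
  multiply it by a nonzero factor; so it vanishes on a whole orbit or nowhere on it.
\<close>

lemma regular_orbit_s3_nonzero:
  assumes "regular_orbit 2 Orb" "jet_of 2 E x \<in> Orb"
  shows "s3 E x \<noteq> 0"
proof -
  obtain \<theta> where \<theta>: "regular_jet 2 \<theta>" "Orb = jet_orbit 2 \<theta>"
    using assms(1) by (auto simp: regular_orbit_def)
  obtain E0 x0 where 0: "\<theta> = jet_of 2 E0 x0" "s3 E0 x0 \<noteq> 0"
    using \<theta>(1) by (auto simp: regular_jet_def)
  obtain E1 F1 U f g h x1 where 1: "jet_of 2 E x = jet_of 2 F1 (f x1)" "abel_equation F1"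
      "transforms U f g h E1 F1" "x1 \<in> U" "\<theta> = jet_of 2 E1 x1"
    using assms(2) \<theta>(2) unfolding jet_orbit_def by blast
  have "s3 E1 x1 \<noteq> 0" using s3_eq_if_jets_eq[of E0 x0 E1 x1] 0 1(5) by simp
  then have "s3 F1 (f x1) \<noteq> 0" using s3_transforms[OF 1(2,3,4)] by auto
  then show ?thesis using s3_eq_if_jets_eq[OF 1(1)] by simp
qed

lemma regular_interval_s3_nonzero:
  "regular_interval E \<Delta> \<Longrightarrow> x \<in> \<Delta> \<Longrightarrow> s3 E x \<noteq> 0"
  unfolding regular_interval_def using regular_orbit_s3_nonzero by blast

section \<open>Parametrized curves with a local coordinate\<close>

text \<open>
  A Gronwall estimate: \<open>u\<^sup>2 e\<^bsup>c x\<^esup>\<close> is nonincreasing to the right of \<open>x\<^sub>0\<close> for \<open>c = -2 C\<close> and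
  nondecreasing to its left for \<open>c = 2 C\<close>, and it vanishes at \<open>x\<^sub>0\<close>.
\<close>

lemma zero_near_if_deriv_bounded_by_self:
  fixes u :: "real \<Rightarrow> real"
  assumes r: "r > 0" and D: "\<And>x. \<bar>x - x0\<bar> < r \<Longrightarrow> (u has_field_derivative u' x) (at x)"
    and bound: "\<And>x. \<bar>x - x0\<bar> < r \<Longrightarrow> \<bar>u' x\<bar> \<le> C * \<bar>u x\<bar>"
    and "u x0 = 0" and x: "\<bar>x - x0\<bar> < r"
  shows "u x = 0"
proof -
  have key: "\<bar>2 * u y * u' y\<bar> \<le> 2 * C * u y ^ 2" if "\<bar>y - x0\<bar> < r" for y
  proof -
    have "\<bar>2 * u y * u' y\<bar> = 2 * \<bar>u y\<bar> * \<bar>u' y\<bar>" by (simp add: abs_mult)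
    also have "\<dots> \<le> 2 * \<bar>u y\<bar> * (C * \<bar>u y\<bar>)"
      by (intro mult_left_mono bound that) simp
    finally show ?thesis by (simp add: power2_eq_square algebra_simps)
  qed
  have DE: "((\<lambda>y. u y ^ 2 * exp (c * y)) has_field_derivative
      (2 * u y * u' y + c * u y ^ 2) * exp (c * y)) (at y)" if "\<bar>y - x0\<bar> < r" for y c
    by (rule derivative_eq_intros D[OF that] refl | simp add: algebra_simps)+
  have "u x ^ 2 * exp (c * x) \<le> 0" if "c = (if x0 \<le> x then - 2 * C else 2 * C)" for c
  proof (cases "x0 \<le> x")
    case True
    have "u x ^ 2 * exp (c * x) \<le> u x0 ^ 2 * exp (c * x0)"
    proof (rule DERIV_nonpos_imp_nonincreasing[OF True, where f = "\<lambda>y. u y ^ 2 * exp (c * y)"])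
      fix y assume y: "x0 \<le> y" "y \<le> x"
      then have yr: "\<bar>y - x0\<bar> < r" using x by auto
      have "2 * u y * u' y + c * u y ^ 2 \<le> 0" using key[OF yr] that True by (auto simp: abs_le_iff)
      then have "(2 * u y * u' y + c * u y ^ 2) * exp (c * y) \<le> 0" by (simp add: mult_nonpos_nonneg)
      then show "\<exists>d. ((\<lambda>y. u y ^ 2 * exp (c * y)) has_field_derivative d) (at y) \<and> d \<le> 0"
        using DE[OF yr] by blast
    qed
    then show ?thesis using assms(4) by simp
  next
    case False
    have "u x ^ 2 * exp (c * x) \<le> u x0 ^ 2 * exp (c * x0)"
    proof (rule DERIV_nonneg_imp_nondecreasing[where f = "\<lambda>y. u y ^ 2 * exp (c * y)"])
      show "x \<le> x0" using False by simp
      fix y assume y: "x \<le> y" "y \<le> x0"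
      then have yr: "\<bar>y - x0\<bar> < r" using x by auto
      have "2 * u y * u' y + c * u y ^ 2 \<ge> 0" using key[OF yr] that False by (auto simp: abs_le_iff)
      then have "(2 * u y * u' y + c * u y ^ 2) * exp (c * y) \<ge> 0" by simp
      then show "\<exists>d. ((\<lambda>y. u y ^ 2 * exp (c * y)) has_field_derivative d) (at y) \<and> 0 \<le> d"
        using DE[OF yr] by blast
    qed
    then show ?thesis using assms(4) by simp
  qed
  then have "u x ^ 2 * exp ((if x0 \<le> x then - 2 * C else 2 * C) * x) \<le> 0" by blast
  then have "u x ^ 2 \<le> 0" by (simp add: mult_le_0_iff)
  then show ?thesis by simp
qed

lemma eventually_zero_if_deriv_bounded_by_self:
  fixes u :: "real \<Rightarrow> real"
  assumes "\<forall>\<^sub>F x in nhds x0. (u has_field_derivative u' x) (at x) \<and> \<bar>u' x\<bar> \<le> C * \<bar>u x\<bar>"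
    and "u x0 = 0"
  shows "\<forall>\<^sub>F x in nhds x0. u x = 0"
proof -
  obtain r where r: "r > 0"
    "\<And>x. \<bar>x - x0\<bar> < r \<Longrightarrow> (u has_field_derivative u' x) (at x) \<and> \<bar>u' x\<bar> \<le> C * \<bar>u x\<bar>"
    using assms(1) unfolding eventually_nhds_metric dist_real_def by blast
  have "u x = 0" if "\<bar>x - x0\<bar> < r" for x
    using zero_near_if_deriv_bounded_by_self[of r x0 u u' C x] r assms(2) that by blast
  then show ?thesis using r(1) unfolding eventually_nhds_metric dist_real_def by blast
qed

lemma DERIV_imp_eventually_linear_bound:
  fixes \<phi> :: "real \<Rightarrow> real"
  assumes "(\<phi> has_field_derivative D) (at t0)" "\<phi> t0 = 0"
  shows "\<forall>\<^sub>F t in nhds t0. \<bar>\<phi> t\<bar> \<le> (\<bar>D\<bar> + 1) * \<bar>t - t0\<bar>"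
proof -
  have "((\<lambda>t. \<bar>(\<phi> t - \<phi> t0) / (t - t0)\<bar>) \<longlongrightarrow> \<bar>D\<bar>) (at t0)"
    using assms(1) unfolding has_field_derivative_iff by (rule tendsto_rabs)
  then have "\<forall>\<^sub>F t in at t0. \<bar>(\<phi> t - \<phi> t0) / (t - t0)\<bar> < \<bar>D\<bar> + 1"
    by (rule order_tendstoD) simp
  then have "\<forall>\<^sub>F t in nhds t0. t \<noteq> t0 \<longrightarrow> \<bar>(\<phi> t - \<phi> t0) / (t - t0)\<bar> < \<bar>D\<bar> + 1"
    by (simp add: eventually_at_filter)
  then show ?thesis
  proof eventually_elim
    case (elim t)
    show ?case
    proof (cases "t = t0")
      case False
      then have "\<bar>\<phi> t\<bar> / \<bar>t - t0\<bar> < \<bar>D\<bar> + 1" using elim assms(2) by (simp add: abs_divide)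
      then show ?thesis using False by (simp add: divide_less_eq)
    qed (use assms(2) in simp)
  qed
qed

lemma isCont_eventually:
  fixes f :: "real \<Rightarrow> 'a::topological_space"
  assumes "isCont f x0" "\<forall>\<^sub>F t in nhds (f x0). P t"
  shows "\<forall>\<^sub>F x in nhds x0. P (f x)"
proof -
  have "filterlim f (nhds (f x0)) (nhds x0)"
    using assms(1) unfolding isCont_def tendsto_at_iff_tendsto_nhds .
  then show ?thesis using assms(2) unfolding filterlim_iff by blast
qed

lemma zero_set_empty_or_all:
  fixes u :: "real \<Rightarrow> real"
  assumes "open_interval \<Delta>" "continuous_on \<Delta> u"
    and "\<And>x. x \<in> \<Delta> \<Longrightarrow> u x = 0 \<Longrightarrow> \<forall>\<^sub>F y in nhds x. u y = 0"
  shows "(\<forall>x\<in>\<Delta>. u x \<noteq> 0) \<or> (\<forall>x\<in>\<Delta>. u x = 0)"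
proof -
  have op: "open \<Delta>" and con: "connected \<Delta>"
    using assms(1) by (auto simp: open_interval_def is_interval_connected_1)
  let ?Z = "{x \<in> \<Delta>. u x = 0}"
  have "closedin (top_of_set \<Delta>) ?Z"
    by (rule continuous_closedin_preimage_constant[OF assms(2)])
  moreover have "open ?Z"
    unfolding open_subopen[of ?Z]
  proof
    fix x assume x: "x \<in> ?Z"
    then have "\<forall>\<^sub>F y in nhds x. y \<in> \<Delta> \<and> u y = 0"
      using assms(3) op by (auto intro: eventually_conj eventually_nhds_in_open)
    then show "\<exists>T. open T \<and> x \<in> T \<and> T \<subseteq> ?Z"
      unfolding eventually_nhds by blast
  qed
  then have "openin (top_of_set \<Delta>) ?Z" by (intro open_subset) auto
  ultimately have "?Z = {} \<or> ?Z = \<Delta>" using con unfolding connected_clopen by blast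
  then show ?thesis by blast
qed

text \<open>
  Where \<open>j\<close> is a coordinate of a parametrized curve, both components of the curve are smooth
  functions of the single function \<open>j \<circ> \<sigma>\<close>.
\<close>

lemma local_coordinate_graph:
  assumes "local_coordinate (\<sigma> ` \<Delta>) j" "open \<Delta>" "x0 \<in> \<Delta>" "isCont \<sigma> (x0::real)"
  shows "\<exists>I \<phi> \<psi>. open I \<and> smooth_on I \<phi> \<and> smooth_on I \<psi> \<and> j (\<sigma> x0) \<in> I \<and>
    (\<forall>\<^sub>F y in nhds x0. \<phi> (j (\<sigma> y)) = fst (\<sigma> y)) \<and> (\<forall>\<^sub>F y in nhds x0. \<psi> (j (\<sigma> y)) = snd (\<sigma> y))"
proof -
  obtain W \<gamma> where W: "open W" "\<sigma> x0 \<in> W" "open (j ` (\<sigma> ` \<Delta> \<inter> W))"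
      "smooth_on (j ` (\<sigma> ` \<Delta> \<inter> W)) (\<lambda>t. fst (\<gamma> t))" "smooth_on (j ` (\<sigma> ` \<Delta> \<inter> W)) (\<lambda>t. snd (\<gamma> t))"
      "\<And>r. r \<in> \<sigma> ` \<Delta> \<inter> W \<Longrightarrow> \<gamma> (j r) = r"
    using assms(1,3) unfolding local_coordinate_def by (meson imageI)
  have "\<forall>\<^sub>F y in nhds x0. \<sigma> y \<in> W"
    using isCont_eventually[OF assms(4) eventually_nhds_in_open[OF W(1,2)]] .
  then have "\<forall>\<^sub>F y in nhds x0. fst (\<gamma> (j (\<sigma> y))) = fst (\<sigma> y) \<and> snd (\<gamma> (j (\<sigma> y))) = snd (\<sigma> y)"
    using eventually_nhds_in_open[OF assms(2,3)] by eventually_elim (use W(6) in auto)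
  moreover have "j (\<sigma> x0) \<in> j ` (\<sigma> ` \<Delta> \<inter> W)" using W(2) assms(3) by blast
  ultimately show ?thesis using W(3-5) unfolding eventually_conj_iff by blast
qed

text \<open>
  This excludes that both invariants are constant along a regular interval.
\<close>

lemma local_coordinate_not_singleton: "\<not> local_coordinate {q} j"
proof
  assume "local_coordinate {q} j"
  then obtain W where "q \<in> W" "open (j ` ({q} \<inter> W))" unfolding local_coordinate_def by blast
  then have "open {j q}" by simp
  then show False using not_open_singleton by blast
qed

text \<open>
  Here \<open>K\<close> is locally a smooth function \<open>\<psi>\<close> of \<open>J\<close>, so \<open>J\<close> solves the first order equation
  \<open>J' = q \<psi>(J)\<close>. At a zero of \<open>J'\<close> also \<open>\<psi>(J)\<close> vanishes, and by uniqueness \<open>J\<close> is the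
  corresponding constant solution nearby. So the zeros of \<open>J'\<close> form an open and closed set; were it
  the whole interval, the curve would be a point.
\<close>

lemma regular_first_coordinate:
  assumes \<Delta>: "open_interval \<Delta>" and sm: "smooth_on \<Delta> J" "smooth_on \<Delta> K" "smooth_on \<Delta> q"
    and ode: "\<And>x. x \<in> \<Delta> \<Longrightarrow> deriv J x = q x * K x" and q0: "\<And>x. x \<in> \<Delta> \<Longrightarrow> q x \<noteq> 0"
    and coord: "local_coordinate ((\<lambda>x. (J x, K x)) ` \<Delta>) fst"
  shows "\<forall>x\<in>\<Delta>. deriv J x \<noteq> 0"
proof -
  have op: "open \<Delta>" and cx: "convex \<Delta>" and ne: "\<Delta> \<noteq> {}"
    using \<Delta> by (auto simp: open_interval_def is_interval_convex_1)
  have DJ: "(J has_field_derivative deriv J x) (at x)" if "x \<in> \<Delta>" for x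
    by (rule smooth_on_DERIV[OF sm(1) that])
  have "\<forall>\<^sub>F y in nhds x0. deriv J y = 0" if x0: "x0 \<in> \<Delta>" and z: "deriv J x0 = 0" for x0
  proof -
    have cont: "isCont (\<lambda>x. (J x, K x)) x0"
      using smooth_on_imp_isCont[OF sm(1) x0] smooth_on_imp_isCont[OF sm(2) x0] by (rule isCont_Pair)
    obtain I \<psi> where \<psi>: "open I" "smooth_on I \<psi>" "J x0 \<in> I" "\<forall>\<^sub>F y in nhds x0. \<psi> (J y) = K y"
      using local_coordinate_graph[OF coord op x0 cont] by auto
    have "K x0 = 0" using ode[OF x0] q0[OF x0] z by simp
    then have "\<psi> (J x0) = 0" using eventually_nhds_x_imp_x[OF \<psi>(4)] by simp
    then obtain C where C: "C \<ge> 0" "\<forall>\<^sub>F t in nhds (J x0). \<bar>\<psi> t\<bar> \<le> C * \<bar>t - J x0\<bar>"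
      using DERIV_imp_eventually_linear_bound[OF smooth_on_DERIV[OF \<psi>(2,3)]]
      by (metis abs_ge_zero add_nonneg_nonneg zero_le_one)
    have 1: "\<forall>\<^sub>F y in nhds x0. \<bar>\<psi> (J y)\<bar> \<le> C * \<bar>J y - J x0\<bar>"
      by (rule isCont_eventually[OF smooth_on_imp_isCont[OF sm(1) x0] C(2)])
    have 2: "\<forall>\<^sub>F y in nhds x0. \<bar>q y\<bar> < \<bar>q x0\<bar> + 1"
      by (rule isCont_eventually[OF smooth_on_imp_isCont[OF sm(3) x0]])
        (auto intro!: order_tendstoD[OF tendsto_rabs[OF filterlim_ident]])
    have "\<forall>\<^sub>F y in nhds x0. ((\<lambda>x. J x - J x0) has_field_derivative deriv J y) (at y) \<and>
        \<bar>deriv J y\<bar> \<le> ((\<bar>q x0\<bar> + 1) * C) * \<bar>J y - J x0\<bar>"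
      using 1 2 \<psi>(4) eventually_nhds_in_open[OF op x0]
    proof eventually_elim
      case (elim y)
      have "((\<lambda>x. J x - J x0) has_field_derivative deriv J y) (at y)"
        using DERIV_diff[OF DJ[OF elim(4)] DERIV_const] by simp
      moreover have "\<bar>deriv J y\<bar> = \<bar>q y\<bar> * \<bar>\<psi> (J y)\<bar>" using ode elim by (simp add: abs_mult)
      then have "\<bar>deriv J y\<bar> \<le> (\<bar>q x0\<bar> + 1) * (C * \<bar>J y - J x0\<bar>)"
        using elim by (auto intro!: mult_mono)
      ultimately show ?case by (simp add: mult.assoc)
    qed
    then have "\<forall>\<^sub>F y in nhds x0. J y - J x0 = 0"
      by (rule eventually_zero_if_deriv_bounded_by_self) simp
    then have "\<forall>\<^sub>F y in nhds x0. \<forall>\<^sub>F z in nhds y. J z = J x0"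
      by (simp add: eventually_eventually)
    then show ?thesis
      by eventually_elim (use deriv_cong_ev[OF _ refl, of J "\<lambda>_. J x0"] in auto)
  qed
  then have "(\<forall>x\<in>\<Delta>. deriv J x \<noteq> 0) \<or> (\<forall>x\<in>\<Delta>. deriv J x = 0)"
    using zero_set_empty_or_all[OF \<Delta> smooth_on_imp_continuous_on[OF smooth_on_deriv[OF sm(1)]]] by blast
  moreover have False if z: "\<forall>x\<in>\<Delta>. deriv J x = 0"
  proof -
    have "\<exists>c. \<forall>x\<in>\<Delta>. J x = c"
      using has_field_derivative_zero_constant[OF cx, of J] DJ z has_field_derivative_at_within by metis
    then obtain c where "\<forall>x\<in>\<Delta>. J x = c" by blast
    moreover have "\<forall>x\<in>\<Delta>. K x = 0" using z ode q0 by auto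
    ultimately have "(\<lambda>x. (J x, K x)) ` \<Delta> = {(c, 0)}" using ne by auto
    then show False using coord local_coordinate_not_singleton by simp
  qed
  ultimately show ?thesis by blast
qed

text \<open>
  Here \<open>J\<close> is locally a smooth function \<open>\<phi>\<close> of \<open>K\<close>, and differentiating gives
  \<open>q K = \<phi>'(K) K'\<close>. Thus \<open>K'\<close> can vanish only together with \<open>K\<close>, and it remains to show that the
  common zeros of \<open>K\<close> and \<open>K'\<close> form an open set. In contrast to the first coordinate, zeros of
  \<open>J'\<close> do occur: for \<open>q = 1\<close>, the parabola \<open>J = x\<^sup>2 / 2\<close>, \<open>K = x\<close> has one at its vertex.
\<close>

lemma regular_second_coordinate:
  assumes \<Delta>: "open_interval \<Delta>" and sm: "smooth_on \<Delta> J" "smooth_on \<Delta> K" "smooth_on \<Delta> q"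
    and ode: "\<And>x. x \<in> \<Delta> \<Longrightarrow> deriv J x = q x * K x" and q0: "\<And>x. x \<in> \<Delta> \<Longrightarrow> q x \<noteq> 0"
    and coord: "local_coordinate ((\<lambda>x. (J x, K x)) ` \<Delta>) snd"
  shows "\<forall>x\<in>\<Delta>. deriv K x \<noteq> 0"
proof -
  have op: "open \<Delta>" and cx: "convex \<Delta>" and ne: "\<Delta> \<noteq> {}"
    using \<Delta> by (auto simp: open_interval_def is_interval_convex_1)
  have DJ: "(J has_field_derivative deriv J x) (at x)" if "x \<in> \<Delta>" for x
    by (rule smooth_on_DERIV[OF sm(1) that])
  have DK: "(K has_field_derivative deriv K x) (at x)" if "x \<in> \<Delta>" for x
    by (rule smooth_on_DERIV[OF sm(2) that])
  have graph: "\<exists>I \<phi>. open I \<and> smooth_on I \<phi> \<and> K x0 \<in> I \<and>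
      (\<forall>\<^sub>F y in nhds x0. q y * K y = deriv \<phi> (K y) * deriv K y)" if x0: "x0 \<in> \<Delta>" for x0
  proof -
    have cont: "isCont (\<lambda>x. (J x, K x)) x0"
      using smooth_on_imp_isCont[OF sm(1) x0] smooth_on_imp_isCont[OF sm(2) x0] by (rule isCont_Pair)
    obtain I \<phi> where \<phi>: "open I" "smooth_on I \<phi>" "K x0 \<in> I" "\<forall>\<^sub>F y in nhds x0. \<phi> (K y) = J y"
      using local_coordinate_graph[OF coord op x0 cont] by auto
    have 1: "\<forall>\<^sub>F y in nhds x0. \<forall>\<^sub>F z in nhds y. J z = \<phi> (K z)"
      unfolding eventually_eventually using \<phi>(4) by (rule eventually_mono) simp
    have 2: "\<forall>\<^sub>F y in nhds x0. K y \<in> I"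
      by (rule isCont_eventually[OF smooth_on_imp_isCont[OF sm(2) x0]
            eventually_nhds_in_open[OF \<phi>(1,3)]])
    have "\<forall>\<^sub>F y in nhds x0. q y * K y = deriv \<phi> (K y) * deriv K y"
      using 1 2 eventually_nhds_in_open[OF op x0]
    proof eventually_elim
      case (elim y)
      have "deriv J y = deriv (\<lambda>z. \<phi> (K z)) y"
        by (rule deriv_cong_ev[OF elim(1) refl])
      also have "\<dots> = deriv \<phi> (K y) * deriv K y"
        by (rule DERIV_imp_deriv[OF DERIV_chain2[OF smooth_on_DERIV[OF \<phi>(2) elim(2)] DK[OF elim(3)]]])
      finally show ?case using ode[OF elim(3)] by simp
    qed
    then show ?thesis using \<phi> by blast
  qed
  let ?u = "\<lambda>x. K x ^ 2 + deriv K x ^ 2"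
  have u0: "?u x = 0 \<longleftrightarrow> K x = 0 \<and> deriv K x = 0" for x
    by (simp add: sum_power2_eq_zero_iff)
  have "\<forall>\<^sub>F y in nhds x0. ?u y = 0" if x0: "x0 \<in> \<Delta>" and "?u x0 = 0" for x0
  proof -
    have z: "K x0 = 0" "deriv K x0 = 0" using that(2) u0 by auto
    obtain I \<phi> where \<phi>: "open I" "smooth_on I \<phi>" "K x0 \<in> I"
        "\<forall>\<^sub>F y in nhds x0. q y * K y = deriv \<phi> (K y) * deriv K y"
      using graph[OF x0] by blast
    have D\<phi>: "smooth_on I (deriv \<phi>)" by (rule smooth_on_deriv[OF \<phi>(2)])
    note cK = smooth_on_imp_isCont[OF sm(2) x0]
      and cK' = smooth_on_imp_isCont[OF smooth_on_deriv[OF sm(2)] x0]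
      and cq = smooth_on_imp_isCont[OF sm(3) x0]
    \<comment> \<open>A nonzero \<open>\<phi>'\<close> bounds \<open>K'\<close> by \<open>K\<close>. A zero of \<open>\<phi>'\<close> bounds \<open>q K\<close> by \<open>C |K K'|\<close>, where
    \<open>C |K'| < |q|\<close> near \<open>x0\<close>.\<close>
    have K0: "\<forall>\<^sub>F y in nhds x0. K y = 0"
    proof (cases "deriv \<phi> (K x0) = 0")
      case False
      define m where "m = \<bar>deriv \<phi> (K x0)\<bar>"
      have m: "m > 0" using False by (simp add: m_def)
      have "isCont (\<lambda>y. deriv \<phi> (K y)) x0"
        by (rule isCont_o2[OF cK smooth_on_imp_isCont[OF D\<phi> \<phi>(3)]])
      then have 1: "\<forall>\<^sub>F y in nhds x0. m / 2 < \<bar>deriv \<phi> (K y)\<bar>"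
        by (rule isCont_eventually)
          (rule order_tendstoD(1)[OF tendsto_rabs[OF filterlim_ident]], use m in \<open>simp flip: m_def\<close>)
      have 2: "\<forall>\<^sub>F y in nhds x0. \<bar>q y\<bar> < \<bar>q x0\<bar> + 1"
        by (rule isCont_eventually[OF cq]) (auto intro!: order_tendstoD[OF tendsto_rabs[OF filterlim_ident]])
      have "\<forall>\<^sub>F y in nhds x0. (K has_field_derivative deriv K y) (at y) \<and>
          \<bar>deriv K y\<bar> \<le> ((\<bar>q x0\<bar> + 1) * 2 / m) * \<bar>K y\<bar>"
        using 1 2 \<phi>(4) eventually_nhds_in_open[OF op x0]
      proof eventually_elim
        case (elim y)
        have "m / 2 * \<bar>deriv K y\<bar> \<le> \<bar>deriv \<phi> (K y)\<bar> * \<bar>deriv K y\<bar>"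
          using elim(1) by (intro mult_right_mono) auto
        also have "\<dots> = \<bar>q y\<bar> * \<bar>K y\<bar>" using elim(3) by (metis abs_mult)
        also have "\<dots> \<le> (\<bar>q x0\<bar> + 1) * \<bar>K y\<bar>" using elim(2) by (intro mult_right_mono) auto
        finally show ?case using DK[OF elim(4)] m by (simp add: field_simps)
      qed
      then show ?thesis by (rule eventually_zero_if_deriv_bounded_by_self) (rule z)
    next
      case True
      then obtain C where C: "C \<ge> 0" "\<forall>\<^sub>F t in nhds (K x0). \<bar>deriv \<phi> t\<bar> \<le> C * \<bar>t - K x0\<bar>"
        using DERIV_imp_eventually_linear_bound[OF smooth_on_DERIV[OF D\<phi> \<phi>(3)]]
        by (metis abs_ge_zero add_nonneg_nonneg zero_le_one)
      have 1: "\<forall>\<^sub>F y in nhds x0. \<bar>deriv \<phi> (K y)\<bar> \<le> C * \<bar>K y - K x0\<bar>"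
        by (rule isCont_eventually[OF cK C(2)])
      have "isCont (\<lambda>y. \<bar>q y\<bar> - C * \<bar>deriv K y\<bar>) x0"
        using cq cK' by (intro continuous_intros)
      then have 2: "\<forall>\<^sub>F y in nhds x0. 0 < \<bar>q y\<bar> - C * \<bar>deriv K y\<bar>"
        by (rule isCont_eventually) (rule order_tendstoD(1)[OF filterlim_ident], use q0[OF x0] z in simp)
      show ?thesis
        using 1 2 \<phi>(4)
      proof eventually_elim
        case (elim y)
        have "\<bar>q y\<bar> * \<bar>K y\<bar> = \<bar>deriv \<phi> (K y)\<bar> * \<bar>deriv K y\<bar>" using elim(3) by (metis abs_mult)
        also have "\<dots> \<le> (C * \<bar>K y\<bar>) * \<bar>deriv K y\<bar>"
          using elim(1) z by (intro mult_right_mono) auto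
        finally have "(\<bar>q y\<bar> - C * \<bar>deriv K y\<bar>) * \<bar>K y\<bar> \<le> 0" by (simp add: algebra_simps)
        then show ?case using elim(2) by (auto simp: mult_le_0_iff)
      qed
    qed
    then have "\<forall>\<^sub>F y in nhds x0. \<forall>\<^sub>F z in nhds y. K z = 0" by (simp add: eventually_eventually)
    then have "\<forall>\<^sub>F y in nhds x0. deriv K y = 0"
      by eventually_elim (use deriv_cong_ev[OF _ refl, of K "\<lambda>_. 0"] in auto)
    with K0 show ?thesis by eventually_elim simp
  qed
  moreover have "continuous_on \<Delta> ?u"
    using smooth_on_imp_continuous_on[OF sm(2)]
      smooth_on_imp_continuous_on[OF smooth_on_deriv[OF sm(2)]]
    by (intro continuous_intros)
  ultimately have alt: "(\<forall>x\<in>\<Delta>. ?u x \<noteq> 0) \<or> (\<forall>x\<in>\<Delta>. ?u x = 0)"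
    using zero_set_empty_or_all[OF \<Delta>] by blast
  have False if "\<forall>x\<in>\<Delta>. ?u x = 0"
  proof -
    have z: "K x = 0" if "x \<in> \<Delta>" for x using u0 \<open>\<forall>x\<in>\<Delta>. ?u x = 0\<close> that by blast
    have "(J has_field_derivative 0) (at x within \<Delta>)" if "x \<in> \<Delta>" for x
      using DJ[OF that] ode[OF that] z[OF that] by (simp add: has_field_derivative_at_within)
    then obtain c where "\<forall>x\<in>\<Delta>. J x = c"
      using has_field_derivative_zero_constant[OF cx, of J] by blast
    then have "(\<lambda>x. (J x, K x)) ` \<Delta> = {(c, 0)}" using ne z by auto
    then show False using coord local_coordinate_not_singleton by simp
  qed
  with alt have u: "?u x \<noteq> 0" if "x \<in> \<Delta>" for x using that by blast
  show ?thesis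
  proof
    fix x assume x: "x \<in> \<Delta>"
    obtain \<phi> where "\<forall>\<^sub>F y in nhds x. q y * K y = deriv \<phi> (K y) * deriv K y"
      using graph[OF x] by blast
    then have "q x * K x = deriv \<phi> (K x) * deriv K x" by (rule eventually_nhds_x_imp_x)
    then show "deriv K x \<noteq> 0" using u[OF x] u0[of x] q0[OF x] by auto
  qed
qed

section \<open>Regular intervals\<close>

lemma fst_sigma_map [simp]: "fst (sigma_map E x) = J1 E x"
  and snd_sigma_map [simp]: "snd (sigma_map E x) = J11 E x"
  by (simp_all add: sigma_map_def)

lemma regular_interval_base: "regular_interval E \<Delta> \<Longrightarrow> open_interval \<Delta> \<and> open \<Delta> \<and> \<Delta> \<subseteq> base E"
  by (simp add: regular_interval_def open_interval_def)

lemma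
  assumes "abel_equation E" "regular_interval E \<Delta>"
  shows smooth_on_J1_regular: "smooth_on \<Delta> (J1 E)"
    and smooth_on_J11_regular: "smooth_on \<Delta> (J11 E)"
  using smooth_on_J1[OF assms(1)] smooth_on_J11[OF assms(1)] regular_interval_base[OF assms(2)]
    regular_interval_s3_nonzero[OF assms(2)] by auto

lemma deriv_J1_eq:
  assumes "s1 E x \<noteq> 0" "s3 E x \<noteq> 0"
  shows "deriv (J1 E) x = root 3 (s3 E x) ^ 2 / s1 E x * J11 E x"
  using assms by (simp add: J11_def)

text \<open>
  The analytic content of regularity: the curve is traversed by its coordinate with nonzero speed,
  although the definition only speaks of the image of \<open>\<sigma>\<close>. The lemmas \<open>regular_first_coordinate\<close> and
  \<open>regular_second_coordinate\<close> apply with \<open>q = s\<^sub>3\<^bsup>2/3\<^esup> / s\<^sub>1\<close>, as \<open>J\<^sub>1\<^sub>1 = J\<^sub>1' / q\<close>.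
\<close>

lemma coordinate_deriv_nonzero:
  assumes E: "abel_equation E" and \<Delta>: "regular_interval E \<Delta>"
    and j: "j = fst \<or> j = snd" "local_coordinate (sigma_map E ` \<Delta>) j" and x: "x \<in> \<Delta>"
  shows "deriv (\<lambda>x. j (sigma_map E x)) x \<noteq> 0"
proof -
  note base = regular_interval_base[OF \<Delta>]
  note J = smooth_on_J1_regular[OF E \<Delta>] smooth_on_J11_regular[OF E \<Delta>]
  let ?q = "\<lambda>x. root 3 (s3 E x) ^ 2 / s1 E x"
  have a: "s1 E x \<noteq> 0" if "x \<in> \<Delta>" for x
    using E base that by (auto simp: abel_equation_def s1_def)
  note s3 = regular_interval_s3_nonzero[OF \<Delta>]
  have "smooth_on \<Delta> (ca E)" "smooth_on \<Delta> (s3 E)"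
    using E smooth_on_s3[OF E] base smooth_on_subset unfolding abel_equation_def by blast+
  then have q: "smooth_on \<Delta> ?q"
    using a s3 base unfolding s1_def by (intro smooth_intros) auto
  have ode: "deriv (J1 E) x = ?q x * J11 E x" and q0: "?q x \<noteq> 0" if "x \<in> \<Delta>" for x
    using deriv_J1_eq[OF a s3] a s3 that by auto
  have S: "sigma_map E = (\<lambda>x. (J1 E x, J11 E x))" by (auto simp: sigma_map_def)
  from j(1) show ?thesis
  proof
    assume "j = fst"
    then show ?thesis
      using regular_first_coordinate[OF _ J q ode q0] base j(2) x unfolding S by simp
  next
    assume "j = snd"
    then show ?thesis
      using regular_second_coordinate[OF _ J q ode q0] base j(2) x unfolding S by simp
  qed
qed

lemma regular_interval_local_coordinate:
  assumes "regular_interval E \<Delta>"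
  obtains j where "j = fst \<or> j = snd" "local_coordinate (sigma_map E ` \<Delta>) j"
  using assms unfolding regular_interval_def by blast

lemma smooth_on_coordinate:
  assumes "abel_equation E" "regular_interval E \<Delta>" "j = fst \<or> j = snd"
  shows "smooth_on \<Delta> (\<lambda>x. j (sigma_map E x))"
  using assms(3) smooth_on_J1_regular[OF assms(1,2)] smooth_on_J11_regular[OF assms(1,2)]
  by auto

text \<open>
  As the coordinate has nonzero speed, \<open>\<sigma>\<close> restricted to the smaller interval is itself a global regular
  parametrization of its image, with inverse \<open>v \<circ> j\<close> where \<open>v\<close> inverts \<open>w = j \<circ> \<sigma>\<close>.
\<close>

lemma regular_interval_subinterval:
  assumes E: "abel_equation E" and \<Delta>: "regular_interval E \<Delta>" and \<Delta>': "open_interval \<Delta>'" "\<Delta>' \<subseteq> \<Delta>"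
  shows "regular_interval E \<Delta>'"
proof -
  obtain j where j: "j = fst \<or> j = snd" "local_coordinate (sigma_map E ` \<Delta>) j"
    using regular_interval_local_coordinate[OF \<Delta>] .
  let ?S = "sigma_map E ` \<Delta>'"
  define w where "w x = j (sigma_map E x)" for x
  define v where "v = inv_into \<Delta>' w"
  have w: "smooth_on \<Delta>' w"
    using smooth_on_subset[OF smooth_on_coordinate[OF E \<Delta> j(1)] \<Delta>'(2)] by (simp add: w_def[abs_def])
  have w': "deriv w x \<noteq> 0" if "x \<in> \<Delta>'" for x
    using coordinate_deriv_nonzero[OF E \<Delta> j, of x] \<Delta>'(2) that by (auto simp: w_def[abs_def])
  note inv = smooth_inverse_function[OF \<Delta>'(1) w w', folded v_def]
  have vw: "v (w x) = x" if "x \<in> \<Delta>'" for x using inv(1) that by (simp add: v_def)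
  have op: "open (w ` \<Delta>')" using inv(2) by (simp add: open_interval_def)
  have J: "smooth_on \<Delta>' (J1 E)" "smooth_on \<Delta>' (J11 E)"
    using smooth_on_J1_regular[OF E \<Delta>] smooth_on_J11_regular[OF E \<Delta>] \<Delta>'(2) smooth_on_subset by blast+
  have jS: "j ` ?S = w ` \<Delta>'" by (auto simp: w_def)
  have v\<Delta>': "v ` w ` \<Delta>' \<subseteq> \<Delta>'" using vw by auto
  have hom: "homeomorphism \<Delta>' ?S (sigma_map E) (\<lambda>r. v (j r))"
  proof (rule homeomorphismI)
    show "continuous_on \<Delta>' (sigma_map E)"
      unfolding sigma_map_def[abs_def] using J[THEN smooth_on_imp_continuous_on]
      by (intro continuous_on_Pair)
    have "continuous_on ?S j" using j(1) continuous_on_fst[OF continuous_on_id] continuous_on_snd[OF continuous_on_id] by auto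
    then show "continuous_on ?S (\<lambda>r. v (j r))"
      using continuous_on_compose2[OF smooth_on_imp_continuous_on[OF inv(3)]] jS by blast
  qed (use vw in \<open>auto simp: w_def\<close>)
  have curve: "smooth_curve ?S"
    unfolding smooth_curve_def
  proof
    fix q assume "q \<in> ?S"
    have "\<forall>t\<in>\<Delta>'. (deriv (\<lambda>t. fst (sigma_map E t)) t, deriv (\<lambda>t. snd (sigma_map E t)) t) \<noteq> (0, 0)"
      using w' j(1) by (auto simp: w_def[abs_def])
    then have "open UNIV \<and> q \<in> UNIV \<and> open_interval \<Delta>' \<and>
        smooth_on \<Delta>' (\<lambda>t. fst (sigma_map E t)) \<and> smooth_on \<Delta>' (\<lambda>t. snd (sigma_map E t)) \<and>
        (\<forall>t\<in>\<Delta>'. (deriv (\<lambda>t. fst (sigma_map E t)) t, deriv (\<lambda>t. snd (sigma_map E t)) t) \<noteq> (0, 0)) \<and>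
        homeomorphism \<Delta>' (?S \<inter> UNIV) (sigma_map E) (\<lambda>r. v (j r))"
      using hom J \<Delta>'(1) by (simp add: sigma_map_def)
    then show "\<exists>W T \<gamma> \<rho>. open W \<and> q \<in> W \<and> open_interval T \<and>
        smooth_on T (\<lambda>t. fst (\<gamma> t)) \<and> smooth_on T (\<lambda>t. snd (\<gamma> t)) \<and>
        (\<forall>t\<in>T. (deriv (\<lambda>t. fst (\<gamma> t)) t, deriv (\<lambda>t. snd (\<gamma> t)) t) \<noteq> (0, 0)) \<and>
        homeomorphism T (?S \<inter> W) \<gamma> \<rho>"
      by blast
  qed
  have vS: "sigma_map E (v (j r)) = r" if "r \<in> ?S" for r
    using that vw by (auto simp: w_def)
  have lc: "local_coordinate ?S j"
    unfolding local_coordinate_def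
  proof
    fix q assume "q \<in> ?S"
    have "smooth_on (w ` \<Delta>') (\<lambda>t. J1 E (v t))" "smooth_on (w ` \<Delta>') (\<lambda>t. J11 E (v t))"
      using smooth_on_compose[OF op inv(3) _ v\<Delta>'] J by blast+
    then have "open UNIV \<and> q \<in> UNIV \<and> open (j ` (?S \<inter> UNIV)) \<and>
        smooth_on (j ` (?S \<inter> UNIV)) (\<lambda>t. fst (sigma_map E (v t))) \<and>
        smooth_on (j ` (?S \<inter> UNIV)) (\<lambda>t. snd (sigma_map E (v t))) \<and>
        (\<forall>r \<in> ?S \<inter> UNIV. sigma_map E (v (j r)) = r)"
      using op vS by (simp add: jS)
    then show "\<exists>W \<gamma>. open W \<and> q \<in> W \<and> open (j ` (?S \<inter> W)) \<and>
        smooth_on (j ` (?S \<inter> W)) (\<lambda>t. fst (\<gamma> t)) \<and> smooth_on (j ` (?S \<inter> W)) (\<lambda>t. snd (\<gamma> t)) \<and>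
        (\<forall>r \<in> ?S \<inter> W. \<gamma> (j r) = r)"
      by (intro exI[of _ UNIV] exI[of _ "\<lambda>t. sigma_map E (v t)"])
  qed
  have "local_coordinate ?S fst \<or> local_coordinate ?S snd"
    using lc j(1) by auto
  moreover have "\<Delta>' \<subseteq> base E" "\<forall>x\<in>\<Delta>'. \<exists>Orb. regular_orbit 2 Orb \<and> jet_of 2 E x \<in> Orb"
    using \<Delta> \<Delta>'(2) unfolding regular_interval_def by auto
  ultimately show ?thesis
    using \<Delta>'(1) curve unfolding regular_interval_def by (intro conjI)
qed

section \<open>Equivalence and the invariant curve\<close>

text \<open>
  Invariance gives \<open>\<sigma>\<^sub>E = \<sigma>\<^sub>F \<circ> f\<close>. The domain of the transformation need not be a regular interval
  of \<open>E\<close>, nor its image one of \<open>F\<close>, so it is shrunk to a ball that fits into regular intervals on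
  both sides.
\<close>

lemma locally_equivalent_imp_same_curve:
  assumes E: "abel_equation E" "regular E" and F: "abel_equation F" "regular F"
    and "locally_equivalent E F"
  shows "\<exists>\<Delta>\<^sub>E \<Delta>\<^sub>F. regular_interval E \<Delta>\<^sub>E \<and> regular_interval F \<Delta>\<^sub>F \<and>
       sigma_map E ` \<Delta>\<^sub>E = sigma_map F ` \<Delta>\<^sub>F"
proof -
  obtain U f g h where tr: "transforms U f g h E F"
    using assms(5) by (auto simp: locally_equivalent_def)
  then have U: "open U" "U \<noteq> {}" "U \<subseteq> base E" "f ` U \<subseteq> base F" and f: "smooth_on U f"
    and f': "\<And>x. x \<in> U \<Longrightarrow> deriv f x \<noteq> 0"
    by (auto simp: transforms_def point_transformation_def open_interval_def)
  obtain x0 where x0: "x0 \<in> U" using U(2) by blast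
  obtain \<Delta> where \<Delta>: "x0 \<in> \<Delta>" "regular_interval E \<Delta>"
    using E(2) U(3) x0 by (auto simp: regular_def regular_at_def)
  obtain \<Delta>' where \<Delta>': "f x0 \<in> \<Delta>'" "regular_interval F \<Delta>'"
    using F(2) U(4) x0 by (auto simp: regular_def regular_at_def)
  have "open (U \<inter> f -` \<Delta>')"
    by (rule continuous_open_preimage[OF smooth_on_imp_continuous_on[OF f] U(1)])
      (use regular_interval_base[OF \<Delta>'(2)] in simp)
  then have "open (U \<inter> f -` \<Delta>' \<inter> \<Delta>)"
    using regular_interval_base[OF \<Delta>(2)] by (metis open_Int)
  moreover have "x0 \<in> U \<inter> f -` \<Delta>' \<inter> \<Delta>" using x0 \<Delta>(1) \<Delta>'(1) by simp
  ultimately obtain e where e: "e > 0" "ball x0 e \<subseteq> U \<inter> f -` \<Delta>' \<inter> \<Delta>"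
    by (rule openE)
  let ?B = "ball x0 e"
  have B: "open_interval ?B"
    using e(1) by (simp add: open_interval_def is_interval_ball_real)
  have BU: "?B \<subseteq> U" "?B \<subseteq> \<Delta>" "f ` ?B \<subseteq> \<Delta>'" using e(2) by auto
  have fB: "open_interval (f ` ?B)"
    using smooth_inverse_function(2)[OF B smooth_on_subset[OF f BU(1)]] f' BU(1) by blast
  have "s3 F (f x) \<noteq> 0" if "x \<in> U" for x
    using F(2) U(4) that regular_interval_s3_nonzero unfolding regular_def regular_at_def by blast
  then have "sigma_map E x = sigma_map F (f x)" if "x \<in> ?B" for x
    using sigma_map_eq_if_transforms[OF F(1) tr] BU(1) that by blast
  then have "sigma_map E ` ?B = sigma_map F ` f ` ?B" by (auto simp: image_iff)
  then show ?thesis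
    using regular_interval_subinterval[OF E(1) \<Delta>(2) B BU(2)]
      regular_interval_subinterval[OF F(1) \<Delta>'(2) fB BU(3)] by blast
qed

text \<open>
  At a simple zero of \<open>K\<close>, where the equation \<open>m K = 0\<close> says nothing about \<open>m\<close>, its
  derivative does.
\<close>

lemma cofactor_zero_at_simple_zero:
  assumes U: "open U" "x \<in> U" and m: "smooth_on U m" and K: "smooth_on U K"
    and prod: "\<And>x. x \<in> U \<Longrightarrow> m x * K x = 0"
    and simple: "K x = 0 \<Longrightarrow> deriv K x \<noteq> 0"
  shows "m x = 0"
proof (cases "K x = 0")
  case True
  have D: "((\<lambda>x. m x * K x) has_field_derivative m x * deriv K x + deriv m x * K x) (at x)"
    by (rule DERIV_mult'[OF smooth_on_DERIV[OF m U(2)] smooth_on_DERIV[OF K U(2)]])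
  have "deriv (\<lambda>x. m x * K x) x = deriv (\<lambda>x. 0) x"
    by (rule deriv_cong_open[OF U]) (rule prod)
  then have "m x * deriv K x = 0" using DERIV_imp_deriv[OF D] True by simp
  then show ?thesis using simple[OF True] by simp
qed (use prod[OF U(2)] in simp)

text \<open>
  The common coordinate \<open>j\<close> of the curve identifies both intervals with the same range of values,
  so \<open>f = (j \<circ> \<sigma>\<^sub>F)\<^sup>-\<^sup>1 \<circ> (j \<circ> \<sigma>\<^sub>E)\<close> is a diffeomorphism with \<open>\<sigma>\<^sub>E = \<sigma>\<^sub>F \<circ> f\<close>. Equality of the
  second component of \<open>\<sigma>\<close> makes the operators \<open>\<nabla>\<close> agree under \<open>f\<close> wherever \<open>J\<^sub>1\<^sub>1 \<noteq> 0\<close>. A zero of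
  \<open>J\<^sub>1\<^sub>1\<close> is one of \<open>J\<^sub>1'\<close>, so \<open>J\<^sub>1\<close> is not the coordinate there, \<open>J\<^sub>1\<^sub>1\<close> is, and the zero is simple.
\<close>

lemma same_curve_imp_locally_equivalent:
  assumes E: "abel_equation E" "regular_interval E \<Delta>" and F: "abel_equation F" "regular_interval F \<Delta>'"
    and eq: "sigma_map E ` \<Delta> = sigma_map F ` \<Delta>'"
  shows "locally_equivalent E F"
proof -
  obtain j where j: "j = fst \<or> j = snd" "local_coordinate (sigma_map E ` \<Delta>) j"
    using regular_interval_local_coordinate[OF E(2)] .
  have jF: "local_coordinate (sigma_map F ` \<Delta>') j" using j(2) eq by simp
  define u where "u x = j (sigma_map E x)" for x
  define w where "w x = j (sigma_map F x)" for x
  define f where "f x = inv_into \<Delta>' w (u x)" for x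
  have \<Delta>: "open_interval \<Delta>" "open \<Delta>" "\<Delta> \<subseteq> base E" using regular_interval_base[OF E(2)] by auto
  have \<Delta>': "open_interval \<Delta>'" "\<Delta>' \<subseteq> base F" using regular_interval_base[OF F(2)] by auto
  have u: "smooth_on \<Delta> u" "\<And>x. x \<in> \<Delta> \<Longrightarrow> deriv u x \<noteq> 0"
    unfolding u_def using smooth_on_coordinate[OF E j(1)] coordinate_deriv_nonzero[OF E j] by auto
  have w: "smooth_on \<Delta>' w" "\<And>x. x \<in> \<Delta>' \<Longrightarrow> deriv w x \<noteq> 0"
    unfolding w_def using smooth_on_coordinate[OF F j(1)] coordinate_deriv_nonzero[OF F j(1) jF] by auto
  note inv = smooth_inverse_function[OF \<Delta>'(1) w]
  have \<sigma>: "sigma_map E x = sigma_map F (f x)" and f\<Delta>: "f x \<in> \<Delta>'" if x: "x \<in> \<Delta>" for x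
  proof -
    obtain z where z: "z \<in> \<Delta>'" "sigma_map E x = sigma_map F z" using eq x by blast
    then have "f x = z" using inv(1) by (simp add: f_def u_def w_def flip: w_def)
    then show "sigma_map E x = sigma_map F (f x)" "f x \<in> \<Delta>'" using z by auto
  qed
  have uw: "u ` \<Delta> \<subseteq> w ` \<Delta>'" using \<sigma> f\<Delta> by (auto simp: u_def w_def)
  have f: "smooth_on \<Delta> f"
    using smooth_on_compose[OF \<Delta>(2) u(1) inv(3) uw] by (simp add: f_def[abs_def])
  have chain: "((\<lambda>x. k (f x)) has_field_derivative deriv k (f x) * deriv f x) (at x)"
    if "smooth_on \<Delta>' k" "x \<in> \<Delta>" for k x
    by (rule DERIV_chain2[OF smooth_on_DERIV[OF that(1) f\<Delta>[OF that(2)]] smooth_on_DERIV[OF f that(2)]])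
  have f': "deriv f x \<noteq> 0" if x: "x \<in> \<Delta>" for x
  proof -
    have "deriv u x = deriv (\<lambda>x. w (f x)) x"
      by (rule deriv_cong_open[OF \<Delta>(2) x]) (simp add: u_def w_def \<sigma>)
    then show ?thesis using DERIV_imp_deriv[OF chain[OF w(1) x]] u(2)[OF x] by auto
  qed
  note JE = smooth_on_J1_regular[OF E] and KE = smooth_on_J11_regular[OF E]
    and JF = smooth_on_J1_regular[OF F] and KF = smooth_on_J11_regular[OF F]
    and s3E = regular_interval_s3_nonzero[OF E(2)] and s3F = regular_interval_s3_nonzero[OF F(2)]
  have J1: "J1 E x = J1 F (f x)" and J11: "J11 E x = J11 F (f x)" if "x \<in> \<Delta>" for x
    using \<sigma>[OF that] by (auto simp: sigma_map_def)
  have dJ1: "deriv (J1 E) x = deriv (J1 F) (f x) * deriv f x" if x: "x \<in> \<Delta>" for x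
    using deriv_cong_open[OF \<Delta>(2) x J1] DERIV_imp_deriv[OF chain[OF JF x]] by simp
  \<comment> \<open>The defect of the operators \<open>\<nabla>\<close> to agree under \<open>f\<close>.\<close>
  define m where "m x = s1 E x / (root 3 (s3 E x)) ^ 2 * deriv f x - s1 F (f x) / (root 3 (s3 F (f x))) ^ 2" for x
  have smE: "smooth_on \<Delta> (ca E)" "smooth_on \<Delta> (s3 E)"
    using E(1) smooth_on_s3[OF E(1)] \<Delta>(3) smooth_on_subset unfolding abel_equation_def by blast+
  have f\<Delta>': "f ` \<Delta> \<subseteq> base F" using f\<Delta> \<Delta>'(2) by auto
  have smF: "smooth_on \<Delta> (\<lambda>x. ca F (f x))" "smooth_on \<Delta> (\<lambda>x. s3 F (f x))"
    using F(1) smooth_on_s3[OF F(1)] smooth_on_compose[OF \<Delta>(2) f _ f\<Delta>'] unfolding abel_equation_def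
    by blast+
  have "smooth_on \<Delta> (\<lambda>x. m x)"
    unfolding m_def s1_def using s3E s3F f\<Delta> by (intro smooth_intros \<Delta>(2) smE smF f) auto
  then have m: "smooth_on \<Delta> m" by simp
  have mK: "m x * J11 E x = 0" if x: "x \<in> \<Delta>" for x
  proof -
    have "m x * deriv (J1 F) (f x) = 0"
      using J11[OF x] dJ1[OF x] by (simp add: m_def J11_def algebra_simps)
    then show ?thesis using J11[OF x] by (auto simp: J11_def)
  qed
  have nabla: "s1 E x / (root 3 (s3 E x)) ^ 2 * deriv f x = s1 F (f x) / (root 3 (s3 F (f x))) ^ 2"
    if x: "x \<in> \<Delta>" for x
  proof -
    have "deriv (J11 E) x \<noteq> 0" if "J11 E x = 0"
    proof -
      have "deriv (J1 E) x = 0"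
        using that s3E[OF x] E(1) \<Delta>(3) x by (auto simp: J11_def s1_def abel_equation_def)
      then show ?thesis using coordinate_deriv_nonzero[OF E j x] j(1) by auto
    qed
    from cofactor_zero_at_simple_zero[OF \<Delta>(2) x m KE mK this] have "m x = 0" .
    then show ?thesis by (simp add: m_def)
  qed
  show ?thesis
    using transforms_if_J1_and_nabla_agree[OF E(1) F(1) \<Delta>(1,3) f f\<Delta>' f' s3E s3F[OF f\<Delta>] J1 nabla]
    unfolding locally_equivalent_def by blast
qed

theorem theorem3:
  fixes E F :: abel
  assumes "abel_equation E" and "abel_equation F"
    and "regular E" and "regular F"
  shows "locally_equivalent E F \<longleftrightarrow>
    (\<exists>\<Delta>\<^sub>E \<Delta>\<^sub>F. regular_interval E \<Delta>\<^sub>E \<and> regular_interval F \<Delta>\<^sub>F \<and>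
       sigma_map E ` \<Delta>\<^sub>E = sigma_map F ` \<Delta>\<^sub>F)"
  using locally_equivalent_imp_same_curve[OF assms(1,3,2,4)]
    same_curve_imp_locally_equivalent[OF assms(1) _ assms(2)] by blast

end
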